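(* There is an algorithm running in time $2^{O(k)}n^{O(1)}$ that, given a set $X$ of $n$ integers and an integer $k$, detects whether $X$ can be covered with at most $|X|/2-k$ APs, i.e. whether there exist at most $|X|/2-k$ APs, each consisting only of elements of $X$, whose union is $X$.
   Context: An arithmetic progression (AP) is a finite sequence of integers of the form $a, a+d, a+2d, \dots, a+xd$ for integers $a$, $d$ and $x\ge 0$; an AP is identified with the set of its elements. *)

theory Defs
  imports Complex_Main
begin

text \<open>
  The model of computation is a deterministic random access machine under the uniform cost
  measure: a fixed number of registers (the ones a program mentions) and an unbounded memory, all
  holding integers.  The only unit-cost arithmetic is addition, subtraction and comparison.  There
  is no unit-cost multiplication, so a value gains at most one bit per step and the uniform cost
  measure cannot be abused by packing data into huge numbers.  Programs are presented as
  structured while-programs.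
\<close>

datatype aexp =
    Num int
  | Reg nat
  | Mem aexp
  | Add aexp aexp
  | Sub aexp aexp

datatype bexp =
    Less aexp aexp
  | Neg bexp
  | Conj bexp bexp

datatype com =
    Skip
  | Assign nat aexp
  | Store aexp aexp
  | Seq com com
  | Cond bexp com com
  | While bexp com

text \<open>A state consists of the registers and the memory (which has no boundary at address 0).\<close>

type_synonym state = "(nat \<Rightarrow> int) \<times> (int \<Rightarrow> int)"

primrec aval :: "aexp \<Rightarrow> state \<Rightarrow> int" where
  "aval (Num c) s = c"
| "aval (Reg i) s = fst s i"
| "aval (Mem a) s = snd s (aval a s)"
| "aval (Add a b) s = aval a s + aval b s"
| "aval (Sub a b) s = aval a s - aval b s"

primrec bval :: "bexp \<Rightarrow> state \<Rightarrow> bool" where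
  "bval (Less a b) s \<longleftrightarrow> aval a s < aval b s"
| "bval (Neg b) s \<longleftrightarrow> \<not> bval b s"
| "bval (Conj b c) s \<longleftrightarrow> bval b s \<and> bval c s"

primrec acost :: "aexp \<Rightarrow> nat" where
  "acost (Num c) = 1"
| "acost (Reg i) = 1"
| "acost (Mem a) = 1 + acost a"
| "acost (Add a b) = 1 + acost a + acost b"
| "acost (Sub a b) = 1 + acost a + acost b"

primrec bcost :: "bexp \<Rightarrow> nat" where
  "bcost (Less a b) = 1 + acost a + acost b"
| "bcost (Neg b) = 1 + bcost b"
| "bcost (Conj b c) = 1 + bcost b + bcost c"

text \<open>
  \<open>exec p s t s'\<close>: started in \<open>s\<close>, the program \<open>p\<close> halts in \<open>s'\<close> after exactly \<open>t\<close> elementary steps.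
\<close>

inductive exec :: "com \<Rightarrow> state \<Rightarrow> nat \<Rightarrow> state \<Rightarrow> bool" where
  Skip: "exec Skip s 1 s"
| Assign: "exec (Assign i a) s (1 + acost a) ((fst s)(i := aval a s), snd s)"
| Store: "exec (Store a b) s (1 + acost a + acost b) (fst s, (snd s)(aval a s := aval b s))"
| Seq: "exec p s t s' \<Longrightarrow> exec q s' u s'' \<Longrightarrow> exec (Seq p q) s (t + u) s''"
| CondTrue: "bval b s \<Longrightarrow> exec p s t s' \<Longrightarrow> exec (Cond b p q) s (1 + bcost b + t) s'"
| CondFalse: "\<not> bval b s \<Longrightarrow> exec q s t s' \<Longrightarrow> exec (Cond b p q) s (1 + bcost b + t) s'"
| WhileFalse: "\<not> bval b s \<Longrightarrow> exec (While b p) s (1 + bcost b) s"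
| WhileTrue: "bval b s \<Longrightarrow> exec p s t s' \<Longrightarrow> exec (While b p) s' u s'' \<Longrightarrow>
    exec (While b p) s (1 + bcost b + t + u) s''"

inductive_cases SkipE: "exec Skip s t s'"
inductive_cases AssignE: "exec (Assign i a) s t s'"
inductive_cases StoreE: "exec (Store a b) s t s'"
inductive_cases SeqE: "exec (Seq p q) s t s'"
inductive_cases CondE: "exec (Cond b p q) s t s'"
inductive_cases WhileE: "exec (While b p) s t s'"

lemma exec_deterministic:
  "exec p s t s' \<Longrightarrow> exec p s u s'' \<Longrightarrow> u = t \<and> s'' = s'"
proof (induction arbitrary: u s'' rule: exec.induct)
  case (Seq p s t s' q u' s3)
  from Seq.prems show ?case by (rule SeqE) (metis Seq.IH)
next
  case (CondTrue b s p t s' q)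
  from CondTrue.prems show ?case by (rule CondE) (metis CondTrue.IH CondTrue.hyps(1) plus_1_eq_Suc add_Suc)+
next
  case (CondFalse b s q t s' p)
  from CondFalse.prems show ?case by (rule CondE) (metis CondFalse.IH CondFalse.hyps(1) plus_1_eq_Suc add_Suc)+
next
  case (WhileFalse b s p)
  from WhileFalse.prems show ?case by (rule WhileE) (use WhileFalse.hyps in simp_all)
next
  case (WhileTrue b s p t s' u' s3)
  from WhileTrue.prems show ?case
    by (rule WhileE) (metis WhileTrue.IH WhileTrue.hyps(1) plus_1_eq_Suc add_Suc)+
qed (auto elim: SkipE AssignE StoreE)

text \<open>
  An instance is a list \<open>xs\<close> of integers, in any order, and an integer \<open>k\<close>.  Initially register 0
  holds the length of the list, register 1 holds \<open>k\<close>, and the list occupies the memory cells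
  \<open>0, \<dots>, length xs - 1\<close>; everything else is 0.  The answer is read off register 0: 1 for yes, 0 for no.
\<close>

definition input_state :: "int list \<Rightarrow> int \<Rightarrow> state" where
  "input_state xs k =
     ((\<lambda>i. if i = 0 then int (length xs) else if i = 1 then k else 0),
      (\<lambda>j. if 0 \<le> j \<and> j < int (length xs) then xs ! nat j else 0))"

definition answer :: "state \<Rightarrow> int" where
  "answer s = fst s 0"

definition is_AP :: "int set \<Rightarrow> bool" where
  "is_AP S \<longleftrightarrow> (\<exists>a d :: int. \<exists>x :: nat. S = {a + int i * d | i. i \<le> x})"

definition AP_cover :: "int set set \<Rightarrow> int set \<Rightarrow> bool" where
  "AP_cover F X \<longleftrightarrow> finite F \<and> (\<forall>S\<in>F. is_AP S \<and> S \<subseteq> X) \<and> \<Union>F = X"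

definition coverable_below :: "int set \<Rightarrow> int \<Rightarrow> bool" where
  "coverable_below X k \<longleftrightarrow>
     (\<exists>F. AP_cover F X \<and> real (card F) \<le> real (card X) / 2 - real_of_int k)"

end

theory Submission
  imports Defs "HOL-Computational_Algebra.Polynomial"
begin

text \<open>
  Put \<open>K = 2 * k + n mod 2\<close>.  Any two integers form an AP, so the elements missed by some APs can be
  covered in pairs, and everything depends on how many elements a few APs can cover.  If
  \<open>K \<le> 0\<close>, pairs suffice.  Otherwise \<open>X\<close> can be covered with at most \<open>n / 2 - k\<close> APs iff \<open>m\<close> APs can
  cover \<open>t\<close> elements, where \<open>t = min n (3 * K)\<close> and \<open>m = (t - K) / 2\<close>: in a family of more than \<open>K\<close>
  sets with union of size at least \<open>2 * |F| + K\<close>, either some set has at most two private elements and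
  can be dropped, or any \<open>K\<close> of the sets already cover \<open>3 * K\<close> elements.

  Whether \<open>m\<close> APs cover \<open>t = O(k)\<close> elements is decided deterministically in the exterior algebra of
  dimension \<open>4 ^ t\<close>.  The element at position \<open>v\<close> becomes the bivector spanned by the Vandermonde
  vectors at \<open>2 ^ (2 * v)\<close> and \<open>2 ^ (2 * v + 1)\<close>.  Sum the products of these bivectors over all ways to
  pick elements from \<open>m\<close> APs.  A product of \<open>t\<close> bivectors has a Vandermonde determinant as top
  coefficient, which is 0 if an element is repeated and positive otherwise, whatever the order of the
  elements.  Nothing cancels, so the top coefficient of the sum is positive iff \<open>t\<close> distinct
  elements can be picked.
\<close>

section \<open>Exterior algebra and Vandermonde vectors\<close>

text \<open>
  A multivector is the table of its coefficients, indexed by bit masks.  \<open>wedge t q\<close> multiplies it from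
  the left by the vector \<open>(1, q, \<dots>, q ^ (t - 1))\<close> and \<open>contract t p\<close> contracts it with the covector \<open>p\<close>;
  both recursions split off the topmost basis vector.
\<close>

primrec wedge :: "nat \<Rightarrow> int \<Rightarrow> (nat \<Rightarrow> int) \<Rightarrow> nat \<Rightarrow> int" where
  "wedge 0 q x M = 0"
| "wedge (Suc t) q x M =
     (if M < 2 ^ t then wedge t q x M
      else q ^ t * x (M - 2 ^ t) - wedge t q (\<lambda>A. x (A + 2 ^ t)) (M - 2 ^ t))"

primrec contract :: "nat \<Rightarrow> (nat \<Rightarrow> int) \<Rightarrow> (nat \<Rightarrow> int) \<Rightarrow> nat \<Rightarrow> int" where
  "contract 0 p x M = 0"
| "contract (Suc t) p x M =
     (if M < 2 ^ t then p t * x (M + 2 ^ t) + contract t p x M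
      else - contract t p (\<lambda>A. x (A + 2 ^ t)) (M - 2 ^ t))"

lemma wedge_cong:
  "M < 2 ^ t \<Longrightarrow> (\<And>A. A < 2 ^ t \<Longrightarrow> x A = y A) \<Longrightarrow> wedge t q x M = wedge t q y M"
proof (induction t arbitrary: x y M)
  case (Suc t)
  have "wedge t q x M = wedge t q y M" if "M < 2 ^ t"
    using that Suc.prems by (intro Suc.IH) auto
  moreover have "wedge t q (\<lambda>A. x (A + 2 ^ t)) (M - 2 ^ t) = wedge t q (\<lambda>A. y (A + 2 ^ t)) (M - 2 ^ t)"
    if "\<not> M < 2 ^ t"
    using that Suc.prems by (intro Suc.IH) auto
  ultimately show ?case using Suc.prems by auto
qed simp

lemma contract_cong:
  "M < 2 ^ t \<Longrightarrow> (\<And>A. A < 2 ^ t \<Longrightarrow> x A = y A) \<Longrightarrow> contract t p x M = contract t p y M"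
proof (induction t arbitrary: x y M)
  case (Suc t)
  have "contract t p x M = contract t p y M" if "M < 2 ^ t"
    using that Suc.prems by (intro Suc.IH) auto
  moreover have "contract t p (\<lambda>A. x (A + 2 ^ t)) (M - 2 ^ t) = contract t p (\<lambda>A. y (A + 2 ^ t)) (M - 2 ^ t)"
    if "\<not> M < 2 ^ t"
    using that Suc.prems by (intro Suc.IH) auto
  ultimately show ?case using Suc.prems by auto
qed simp

lemma wedge_linear:
  "wedge t q (\<lambda>A. a * x A + b * y A) M = a * wedge t q x M + b * wedge t q y M"
  by (induction t arbitrary: x y M) (auto simp: algebra_simps)

lemma contract_linear:
  "contract t p (\<lambda>A. a * x A + b * y A) M = a * contract t p x M + b * contract t p y M"
  by (induction t arbitrary: x y M) (auto simp: algebra_simps)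

lemma wedge_zero: "wedge t q (\<lambda>A. 0) M = 0"
  using wedge_linear[of t q 0 "\<lambda>_. 0" 0 "\<lambda>_. 0" M] by simp

lemma contract_zero: "contract t p (\<lambda>A. 0) M = 0"
  using contract_linear[of t p 0 "\<lambda>_. 0" 0 "\<lambda>_. 0" M] by simp

lemma wedge_add: "wedge t q (\<lambda>A. x A + y A) M = wedge t q x M + wedge t q y M"
  using wedge_linear[of t q 1 x 1 y M] by simp

text \<open>Anticommutation of interior and exterior multiplication:
  \<open>\<Sum>a<t. p a * q ^ a\<close> is the value of the covector \<open>p\<close> on the vector
  \<open>(1, q, ...)\<close>.\<close>

lemma contract_wedge:
  "M < 2 ^ t \<Longrightarrow>
     contract t p (wedge t q x) M + wedge t q (contract t p x) M = (\<Sum>a<t. p a * q ^ a) * x M"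
proof (induction t arbitrary: x M)
  case (Suc t)
  let ?x1 = "\<lambda>A. x (A + 2 ^ t)"
  show ?case
  proof (cases "M < 2 ^ t")
    case True
    have "contract t p (wedge (Suc t) q x) M = contract t p (wedge t q x) M"
      using True by (intro contract_cong) auto
    moreover have "wedge t q (contract (Suc t) p x) M
        = wedge t q (\<lambda>A. p t * ?x1 A + 1 * contract t p x A) M"
      using True by (intro wedge_cong) auto
    moreover have "contract (Suc t) p (wedge (Suc t) q x) M
        = p t * (q ^ t * x M - wedge t q ?x1 M) + contract t p (wedge (Suc t) q x) M"
      using True by simp
    moreover have "wedge (Suc t) q (contract (Suc t) p x) M = wedge t q (contract (Suc t) p x) M"
      using True by simp
    ultimately show ?thesis
      using Suc.IH[OF True, of x] by (simp only: wedge_linear) (simp add: algebra_simps)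
  next
    case False
    define N where "N = M - 2 ^ t"
    have N: "N < 2 ^ t" using False Suc.prems by (auto simp: N_def)
    \<comment> \<open>The cross terms \<open>q ^ t * contract t p x N\<close> cancel; the summand
      for \<open>t\<close> and the induction hypothesis for \<open>?x1\<close> remain.\<close>
    have "contract t p (\<lambda>A. wedge (Suc t) q x (A + 2 ^ t)) N
        = contract t p (\<lambda>A. q ^ t * x A + (- 1) * wedge t q ?x1 A) N"
      using N by (intro contract_cong) auto
    moreover have "wedge t q (\<lambda>A. contract (Suc t) p x (A + 2 ^ t)) N
        = wedge t q (\<lambda>A. (- 1) * contract t p ?x1 A + 0 * 0) N"
      using N by (intro wedge_cong) auto
    ultimately show ?thesis
      using False N Suc.prems Suc.IH[OF N, of ?x1]
      by (simp only: wedge_linear contract_linear contract.simps wedge.simps if_False N_def[symmetric])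
        (simp add: N_def algebra_simps)
  qed
qed simp

section \<open>Products of Vandermonde vectors\<close>

definition unit_vec :: "nat \<Rightarrow> int" where
  "unit_vec M = (if M = 0 then 1 else 0)"

primrec blade :: "nat \<Rightarrow> int list \<Rightarrow> nat \<Rightarrow> int" where
  "blade t [] = unit_vec"
| "blade t (q # qs) = wedge t q (blade t qs)"

text \<open>A mask below \<open>2 ^ t\<close> involves only the first \<open>t\<close> basis
  vectors, so the last coordinate of the factors does not enter.\<close>

lemma blade_Suc: "M < 2 ^ t \<Longrightarrow> blade (Suc t) qs M = blade t qs M"
  by (induction qs arbitrary: M) (auto intro: wedge_cong)

lemma contract_unit_vec: "M < 2 ^ t \<Longrightarrow> contract t p unit_vec M = 0"
proof (induction t arbitrary: M)
  case (Suc t)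
  have "contract t p (\<lambda>A. unit_vec (A + 2 ^ t)) (M - 2 ^ t) = 0"
    by (simp add: unit_vec_def contract_zero)
  then show ?case using Suc by (auto simp: unit_vec_def)
qed simp

text \<open>By anticommutation the contraction moves past every factor on which the covector
  vanishes, until it meets the unit.\<close>

lemma contract_blade:
  assumes "\<And>q. q \<in> set qs \<Longrightarrow> (\<Sum>a<t. p a * q ^ a) = 0" "M < 2 ^ t"
  shows "contract t p (blade t qs) M = 0"
  using assms
proof (induction qs arbitrary: M)
  case Nil
  then show ?case by (simp add: contract_unit_vec)
next
  case (Cons q qs)
  have "wedge t q (contract t p (blade t qs)) M = wedge t q (\<lambda>_. 0) M"
    using Cons by (intro wedge_cong) auto
  then show ?case
    using contract_wedge[OF Cons.prems(2), of p q "blade t qs"] Cons.prems(1)[of q]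
    by (simp add: wedge_zero)
qed

text \<open>Contraction lowers the degree, so nothing can land on the full mask.\<close>

lemma contract_top: "contract t p x (2 ^ t - 1) = 0"
proof (induction t arbitrary: x)
  case (Suc t)
  have "(2::nat) ^ Suc t - 1 - 2 ^ t = 2 ^ t - 1" by simp
  moreover have "\<not> (2::nat) ^ Suc t - 1 < 2 ^ t" by auto
  ultimately show ?case using Suc.IH by (simp only: contract.simps if_False)
qed simp

text \<open>The Vandermonde determinant in product form, with the earlier point first in every
  difference.\<close>

primrec vandermonde :: "int list \<Rightarrow> int" where
  "vandermonde [] = 1"
| "vandermonde (q # qs) = (\<Prod>u\<leftarrow>qs. q - u) * vandermonde qs"

text \<open>Contracting with the coefficients of \<open>\<Prod>u\<leftarrow>qs. X - u\<close> kills every factor but the first.\<close>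

lemma blade_top: "length qs = t \<Longrightarrow> blade t qs (2 ^ t - 1) = vandermonde qs"
proof (induction t arbitrary: qs)
  case 0
  then show ?case by (simp add: unit_vec_def)
next
  case (Suc t)
  then obtain q ws where qs: "qs = q # ws" and len: "length ws = t"
    by (cases qs) auto
  define P where "P = (\<Prod>u\<leftarrow>ws. [:- u, 1:])"
  have P: "degree P = length us \<and> lead_coeff P = 1 \<and> (\<forall>z. poly P z = (\<Prod>u\<leftarrow>us. z - u))"
    if "P = (\<Prod>u\<leftarrow>us. [:- u, 1:])" for P and us :: "int list"
    using that
  proof (induction us arbitrary: P)
    case (Cons u us)
    define R where "R = (\<Prod>u\<leftarrow>us. [:- u, 1:])"
    have R: "degree R = length us" "lead_coeff R = 1" "\<And>z. poly R z = (\<Prod>u\<leftarrow>us. z - u)"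
      using Cons.IH[OF R_def] by auto
    have P: "P = [:- u, 1:] * R" using Cons.prems by (simp add: R_def)
    have "R \<noteq> 0" using R(2) by auto
    then have "degree P = Suc (length us)"
      unfolding P using R(1) by (subst degree_mult_eq) auto
    moreover have "lead_coeff P = 1"
      unfolding P using R(2) by (subst lead_coeff_mult) auto
    ultimately show ?case using R(3) by (auto simp: P algebra_simps)
  qed auto
  have deg: "degree P = t" and lc: "coeff P t = 1" and pol: "\<And>z. poly P z = (\<Prod>u\<leftarrow>ws. z - u)"
    using P[OF P_def] len by auto
  have val: "(\<Sum>a<Suc t. coeff P a * z ^ a) = (\<Prod>u\<leftarrow>ws. z - u)" for z
    using pol[of z] deg by (simp only: poly_altdef lessThan_Suc_atMost)
  have "(\<Prod>u\<leftarrow>ws. z - u) = 0" if "z \<in> set ws" for z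
    using that by (induction ws) auto
  then have kill: "contract (Suc t) (coeff P) (blade (Suc t) ws) M = 0" if "M < 2 ^ Suc t" for M
    using that by (intro contract_blade) (auto simp only: val)
  \<comment> \<open>The contraction is evaluated twice at the mask of all bits below the topmost.
    Anticommutation leaves \<open>poly P q\<close> times the smaller blade; the recursion of
    \<open>contract\<close> leaves the wanted top coefficient, because \<open>P\<close> is monic and
    \<open>contract_top\<close> removes the rest.\<close>
  let ?M = "2 ^ t - 1 :: nat"
  have M: "?M < 2 ^ t" "?M < 2 ^ Suc t" by (auto intro: less_le_trans)
  have "wedge (Suc t) q (contract (Suc t) (coeff P) (blade (Suc t) ws)) ?M
      = wedge (Suc t) q (\<lambda>_. 0) ?M"
    using M kill by (intro wedge_cong) auto
  then have "contract (Suc t) (coeff P) (blade (Suc t) qs) ?M = (\<Prod>u\<leftarrow>ws. q - u) * blade (Suc t) ws ?M"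
    using contract_wedge[OF M(2), of "coeff P" q "blade (Suc t) ws"]
    by (simp only: wedge_zero val qs blade.simps)
  also have "blade (Suc t) ws ?M = vandermonde ws"
    using blade_Suc[OF M(1)] Suc.IH[OF len] by simp
  finally have "contract (Suc t) (coeff P) (blade (Suc t) qs) ?M = vandermonde qs"
    by (simp only: qs vandermonde.simps)
  moreover have "?M + 2 ^ t = 2 ^ Suc t - 1" by simp
  ultimately show ?case
    using M(1) lc by (simp only: contract.simps if_True contract_top)
qed

section \<open>Degrees of multivectors\<close>

primrec bits :: "nat \<Rightarrow> nat \<Rightarrow> nat" where
  "bits 0 M = 0"
| "bits (Suc t) M = (if M < 2 ^ t then bits t M else Suc (bits t (M - 2 ^ t)))"

lemma bits_top: "bits t (2 ^ t - 1) = t"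
proof (induction t)
  case (Suc t)
  have "(2::nat) ^ Suc t - 1 - 2 ^ t = 2 ^ t - 1" "\<not> (2::nat) ^ Suc t - 1 < 2 ^ t" by auto
  then show ?case using Suc by (simp only: bits.simps if_False)
qed simp

text \<open>Each term of the product comes from a mask to which one further bit is added.\<close>

lemma wedge_degree:
  "M < 2 ^ t \<Longrightarrow> (\<And>A. A < 2 ^ t \<Longrightarrow> x A \<noteq> 0 \<Longrightarrow> bits t A = k) \<Longrightarrow> wedge t q x M \<noteq> 0 \<Longrightarrow> bits t M = Suc k"
proof (induction t arbitrary: x M k)
  case (Suc t)
  show ?case
  proof (cases "M < 2 ^ t")
    case True
    have "bits t M = Suc k"
    proof (rule Suc.IH[OF True])
      show "wedge t q x M \<noteq> 0" using Suc.prems True by simp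
      show "bits t A = k" if "A < 2 ^ t" "x A \<noteq> 0" for A
        using Suc.prems(2)[of A] that by simp
    qed
    then show ?thesis using True by simp
  next
    case False
    define N where "N = M - 2 ^ t"
    have N: "N < 2 ^ t" using False Suc.prems(1) by (auto simp: N_def)
    have up: "Suc (bits t A) = k" if "A < 2 ^ t" "x (A + 2 ^ t) \<noteq> 0" for A
      using Suc.prems(2)[of "A + 2 ^ t"] that by simp
    have "x N \<noteq> 0 \<or> wedge t q (\<lambda>A. x (A + 2 ^ t)) N \<noteq> 0"
      using Suc.prems(3) False by (auto simp: N_def)
    then have "bits t N = k"
    proof
      assume "x N \<noteq> 0"
      then show ?thesis using Suc.prems(2)[of N] N by simp
    next
      assume w: "wedge t q (\<lambda>A. x (A + 2 ^ t)) N \<noteq> 0"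
      show ?thesis
      proof (cases k)
        \<comment> \<open>A set top bit makes the degree positive, so in degree 0 the upper half of
          \<open>x\<close> vanishes.\<close>
        case 0
        then have "wedge t q (\<lambda>A. x (A + 2 ^ t)) N = wedge t q (\<lambda>_. 0) N"
          using up N by (intro wedge_cong) auto
        then show ?thesis using w by (simp add: wedge_zero)
      next
        case (Suc k')
        then show ?thesis using Suc.IH[OF N _ w, of k'] up by auto
      qed
    qed
    then show ?thesis using False by (simp add: N_def)
  qed
qed simp

lemma blade_degree: "M < 2 ^ t \<Longrightarrow> blade t qs M \<noteq> 0 \<Longrightarrow> bits t M = length qs"
proof (induction qs arbitrary: M)
  case Nil
  have "bits t 0 = 0" by (induction t) auto
  then show ?case using Nil by (auto simp: unit_vec_def split: if_splits)
next
  case (Cons q qs)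
  then show ?case using wedge_degree[of M t "blade t qs" "length qs" q] by auto
qed

text \<open>An element is encoded by a bivector, so that the order of the elements does not affect the sign.\<close>

primrec points :: "nat list \<Rightarrow> int list" where
  "points [] = []"
| "points (v # w) = 2 ^ (2 * v + 1) # 2 ^ (2 * v) # points w"

lemma length_points: "length (points w) = 2 * length w"
  by (induction w) auto

text \<open>For \<open>v \<noteq> u\<close> the exponents \<open>2 * v\<close> and
  \<open>2 * v + 1\<close> lie both below or both above those of \<open>u\<close>, so the four
  differences share a sign and their product is positive.\<close>

lemma pow2_factor:
  fixes v u :: nat
  defines "e \<equiv> (2 ^ (2 * v + 1) - 2 ^ (2 * u + 1)) * (2 ^ (2 * v + 1) - 2 ^ (2 * u))
     * ((2 ^ (2 * v) - 2 ^ (2 * u + 1)) * (2 ^ (2 * v) - (2::int) ^ (2 * u)))"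
  shows "e \<ge> 0 \<and> (e = 0 \<longleftrightarrow> v = u)"
proof -
  have less: "(2::int) ^ a - 2 ^ b < 0" and greater: "(2::int) ^ b - 2 ^ a > 0" if "a < b" for a b :: nat
    using that by simp_all
  consider "v < u" | "v = u" | "u < v" by linarith
  then show ?thesis
  proof cases
    case 1
    then have "e > 0"
      unfolding e_def by (intro mult_pos_pos[OF mult_neg_neg mult_neg_neg] less) simp_all
    then show ?thesis using 1 by simp
  next
    case 2
    then show ?thesis unfolding e_def by (simp only: diff_self mult_zero_right mult_zero_left) simp
  next
    case 3
    then have "e > 0"
      unfolding e_def by (intro mult_pos_pos greater) simp_all
    then show ?thesis using 3 by simp
  qed
qed

lemma points_product:
  fixes w :: "nat list" and v :: nat
  defines "e \<equiv> \<lambda>w. (\<Prod>u\<leftarrow>points w. 2 ^ (2 * v + 1) - u) * (\<Prod>u\<leftarrow>points w. 2 ^ (2 * v) - u)"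
  shows "e w \<ge> 0 \<and> (e w = 0 \<longleftrightarrow> v \<in> set w)"
proof (induction w)
  case Nil
  then show ?case by (simp add: e_def)
next
  case (Cons u w)
  define f where "f = (2 ^ (2 * v + 1) - 2 ^ (2 * u + 1)) * (2 ^ (2 * v + 1) - 2 ^ (2 * u))
     * ((2 ^ (2 * v) - 2 ^ (2 * u + 1)) * (2 ^ (2 * v) - (2::int) ^ (2 * u)))"
  have "e (u # w) = f * e w"
    by (simp only: e_def f_def points.simps list.map prod_list.Cons ac_simps)
  moreover have "f \<ge> 0 \<and> (f = 0 \<longleftrightarrow> v = u)"
    unfolding f_def by (rule pow2_factor)
  ultimately show ?case using Cons by (auto intro: mult_nonneg_nonneg)
qed

lemma vandermonde_points:
  "vandermonde (points w) \<ge> 0 \<and> (vandermonde (points w) = 0 \<longleftrightarrow> \<not> distinct w)"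
proof (induction w)
  case (Cons v w)
  define e where "e = (\<Prod>u\<leftarrow>points w. 2 ^ (2 * v + 1) - u) * (\<Prod>u\<leftarrow>points w. 2 ^ (2 * v) - u)"
  \<comment> \<open>The factor \<open>2 ^ (2 * v)\<close> is the difference of the two points of
    \<open>v\<close> itself.\<close>
  have V: "vandermonde (points (v # w)) = 2 ^ (2 * v) * (e * vandermonde (points w))"
    unfolding e_def by (simp add: algebra_simps)
  have "e \<ge> 0 \<and> (e = 0 \<longleftrightarrow> v \<in> set w)"
    unfolding e_def by (rule points_product)
  then show ?case using Cons unfolding V by (auto intro: mult_nonneg_nonneg)
qed simp

text \<open>A word of another length has the wrong degree for the full mask; for length
  \<open>t\<close> the coefficient is the Vandermonde product.\<close>

lemma blade_points_top:
  "blade (2 * t) (points w) (2 ^ (2 * t) - 1) \<ge> 0 \<and>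
   (blade (2 * t) (points w) (2 ^ (2 * t) - 1) \<noteq> 0 \<longleftrightarrow> length w = t \<and> distinct w)"
proof (cases "length w = t")
  case True
  then show ?thesis
    using blade_top[of "points w" "2 * t"] vandermonde_points[of w] by (auto simp: length_points)
next
  case False
  then have "blade (2 * t) (points w) (2 ^ (2 * t) - 1) = 0"
    using blade_degree[of "2 ^ (2 * t) - 1" "2 * t" "points w"] bits_top[of "2 * t"]
    by (auto simp: length_points)
  then show ?thesis using False by simp
qed

section \<open>Sums of blades over lists of words\<close>

definition table :: "nat \<Rightarrow> nat list list \<Rightarrow> nat \<Rightarrow> int" where
  "table t L M = (\<Sum>w\<leftarrow>L. blade t (points w) M)"

lemma table_append: "table t (L @ L') M = table t L M + table t L' M"
  by (simp add: table_def)

lemma wedge_sum_list: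
  "wedge t q (\<lambda>A. \<Sum>w\<leftarrow>L. h w A) M = (\<Sum>w\<leftarrow>L. wedge t q (h w) M)"
  by (induction L) (simp_all add: wedge_zero wedge_add)

text \<open>Offering \<open>v\<close> to every word is multiplication by one plus the bivector of
  \<open>v\<close>. Hence the table can be updated without storing the words.\<close>

lemma table_extend:
  "table t (L @ map ((#) v) L) M =
     table t L M + wedge t (2 ^ (2 * v + 1)) (wedge t (2 ^ (2 * v)) (table t L)) M"
proof -
  have "wedge t (2 ^ (2 * v)) (table t L) = (\<lambda>A. \<Sum>w\<leftarrow>L. wedge t (2 ^ (2 * v)) (blade t (points w)) A)"
    unfolding table_def by (rule ext) (rule wedge_sum_list)
  then have "table t (map ((#) v) L) M = wedge t (2 ^ (2 * v + 1)) (wedge t (2 ^ (2 * v)) (table t L)) M"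
    by (simp only: wedge_sum_list) (simp add: table_def o_def)
  then show ?thesis by (simp add: table_append)
qed

text \<open>The summands at the full mask are nonnegative, so they cannot cancel.\<close>

lemma table_top:
  "table (2 * t) L (2 ^ (2 * t) - 1) > 0 \<longleftrightarrow> (\<exists>w\<in>set L. length w = t \<and> distinct w)"
proof -
  let ?b = "\<lambda>w. blade (2 * t) (points w) (2 ^ (2 * t) - 1)"
  have nn: "0 \<le> ?b w" and iff: "?b w \<noteq> 0 \<longleftrightarrow> length w = t \<and> distinct w" for w
    using blade_points_top by auto
  have "(\<Sum>w\<leftarrow>L. ?b w) \<ge> 0 \<and> ((\<Sum>w\<leftarrow>L. ?b w) > 0 \<longleftrightarrow> (\<exists>w\<in>set L. ?b w \<noteq> 0))"
  proof (induction L)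
    case (Cons w L)
    then show ?case using nn[of w] by (auto simp: order.strict_iff_order)
  qed simp
  then show ?thesis by (simp only: table_def iff)
qed

section \<open>Covers by arithmetic progressions\<close>

lemma is_AP_pair: "is_AP {a, b}"
proof -
  have "{a, b} = {a + int i * (b - a) | i. i \<le> 1}"
  proof (intro set_eqI iffI)
    fix x assume "x \<in> {a, b}"
    then consider "x = a + int 0 * (b - a)" | "x = a + int 1 * (b - a)" by auto
    then show "x \<in> {a + int i * (b - a) | i. i \<le> 1}" by cases (blast, blast)
  qed (auto simp: le_Suc_eq)
  then show ?thesis unfolding is_AP_def by blast
qed

text \<open>Remove two elements at a time; a last single element is an AP as well and accounts for
  the \<open>+ 1\<close>.\<close>

lemma pair_cover:
  assumes "finite X"
  shows "\<exists>F. AP_cover F X \<and> 2 * card F \<le> card X + 1"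
  using assms
proof (induction "card X" arbitrary: X rule: less_induct)
  case less
  show ?case
  proof (cases "X = {}")
    case True
    then show ?thesis by (intro exI[of _ "{}"]) (simp add: AP_cover_def)
  next
    case False
    then obtain a where a: "a \<in> X" by auto
    show ?thesis
    proof (cases "X = {a}")
      case True
      then show ?thesis
        using is_AP_pair[of a a] by (intro exI[of _ "{{a}}"]) (simp add: AP_cover_def)
    next
      case False
      then obtain b where b: "b \<in> X" "b \<noteq> a" using a by auto
      have "card {a, b} \<le> card X" using a b less.prems by (intro card_mono) auto
      then have card: "card (X - {a, b}) + 2 = card X"
        using a b less.prems by (subst card_Diff_subset) auto
      then obtain F where F: "AP_cover F (X - {a, b})" "2 * card F \<le> card (X - {a, b}) + 1"
        using less.hyps[of "X - {a, b}"] less.prems by auto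
      have "AP_cover (insert {a, b} F) X"
        using F(1) a b is_AP_pair[of a b] by (auto simp: AP_cover_def)
      moreover have "card (insert {a, b} F) \<le> card F + 1"
        using F(1) by (simp add: AP_cover_def card_insert_if)
      ultimately show ?thesis using F(2) card by (intro exI[of _ "insert {a, b} F"]) auto
    qed
  qed
qed

text \<open>The private parts are pairwise disjoint subsets of the union.\<close>

lemma card_Union_private:
  assumes "finite G" "\<And>S. S \<in> G \<Longrightarrow> finite S \<and> 3 \<le> card (S - \<Union>(G - {S}))"
  shows "3 * card G \<le> card (\<Union>G)"
proof -
  let ?p = "\<lambda>S. S - \<Union>(G - {S})"
  have "3 * card G = (\<Sum>S\<in>G. 3)" by simp
  also have "\<dots> \<le> (\<Sum>S\<in>G. card (?p S))" by (rule sum_mono) (use assms in auto)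
  also have "\<dots> = card (\<Union>S\<in>G. ?p S)"
    using assms by (subst card_UN_disjoint) auto
  also have "\<dots> \<le> card (\<Union>G)" using assms by (intro card_mono) auto
  finally show ?thesis .
qed

text \<open>Drop sets with at most two private elements for as long as there are any.\<close>

lemma large_subfamily:
  assumes "finite F" "\<And>S. S \<in> F \<Longrightarrow> finite S" "2 * card F + K \<le> card (\<Union>F)" "K \<le> card F"
  shows "\<exists>G\<subseteq>F. card G = K \<and> 3 * K \<le> card (\<Union>G)"
  using assms
proof (induction "card F" arbitrary: F rule: less_induct)
  case less
  show ?case
  proof (cases "\<exists>S\<in>F. card F > K \<and> card (S - \<Union>(F - {S})) \<le> 2")
    case True
    then obtain S where S: "S \<in> F" "card F > K" "card (S - \<Union>(F - {S})) \<le> 2" by auto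
    let ?F = "F - {S}"
    have card: "card ?F + 1 = card F" using S less.prems(1) by (simp add: card_Suc_Diff1)
    have "\<Union>F = \<Union>?F \<union> (S - \<Union>?F)" using S by auto
    then have "card (\<Union>F) \<le> card (\<Union>?F) + card (S - \<Union>?F)" by (metis card_Un_le)
    \<comment> \<open>Dropping \<open>S\<close> costs the union at most 2 elements and lowers
      \<open>2 * card F\<close> by 2, so the surplus \<open>K\<close> survives.\<close>
    then have "2 * card ?F + K \<le> card (\<Union>?F)" using S card less.prems(3) by linarith
    then obtain G where "G \<subseteq> ?F" "card G = K \<and> 3 * K \<le> card (\<Union>G)"
      using less.hyps[of ?F] less.prems card S(2) by auto
    then show ?thesis by blast
  next
    case False
    show ?thesis
    proof (cases "card F = K")
      case True
      \<comment> \<open>Here \<open>2 * card F + K\<close> equals \<open>3 * K\<close>.\<close>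
      then show ?thesis using less.prems(3) by (intro exI[of _ F]) auto
    next
      case False
      with \<open>\<not> (\<exists>S\<in>F. _ S)\<close> have priv: "3 \<le> card (S - \<Union>(F - {S}))" if "S \<in> F" for S
        using that less.prems(4) by force
      obtain G where G: "G \<subseteq> F" "card G = K"
        using less.prems(4) obtain_subset_with_card_n by metis
      have "3 \<le> card (S - \<Union>(G - {S}))" if "S \<in> G" for S
      proof -
        \<comment> \<open>Elements private in \<open>F\<close> stay private in the smaller family
          \<open>G\<close>.\<close>
        have "card (S - \<Union>(F - {S})) \<le> card (S - \<Union>(G - {S}))"
          using G that less.prems(2) by (intro card_mono) auto
        then show ?thesis using priv[of S] that G by force
      qed
      then have "3 * card G \<le> card (\<Union>G)"
        using G less.prems by (intro card_Union_private) (auto intro: finite_subset)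
      then show ?thesis using G by auto
    qed
  qed
qed

text \<open>\<open>AP_reach X m U\<close>: the set \<open>U\<close> lies in the union of \<open>m\<close> APs, repetitions allowed.\<close>

primrec AP_reach :: "int set \<Rightarrow> nat \<Rightarrow> int set \<Rightarrow> bool" where
  "AP_reach X 0 U \<longleftrightarrow> U = {}"
| "AP_reach X (Suc m) U \<longleftrightarrow> (\<exists>A. is_AP A \<and> A \<subseteq> X \<and> AP_reach X m (U - A))"

lemma AP_reach_mono: "AP_reach X m U \<Longrightarrow> V \<subseteq> U \<Longrightarrow> AP_reach X m V"
proof (induction m arbitrary: U V)
  case (Suc m)
  then obtain A where "is_AP A" "A \<subseteq> X" "AP_reach X m (U - A)" by auto
  moreover from this have "AP_reach X m (V - A)" using Suc by (meson Diff_mono order_refl)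
  ultimately show ?case by auto
qed auto

lemma AP_reach_iff:
  assumes "X \<noteq> {}"
  shows "AP_reach X m U \<longleftrightarrow>
    (\<exists>F. finite F \<and> card F \<le> m \<and> (\<forall>S\<in>F. is_AP S \<and> S \<subseteq> X) \<and> U \<subseteq> \<Union>F)"
proof (induction m arbitrary: U)
  case 0
  then show ?case by (auto intro: exI[of _ "{}"])
next
  case (Suc m)
  show ?case
  proof
    assume "AP_reach X (Suc m) U"
    then obtain A F where A: "is_AP A" "A \<subseteq> X" and F: "finite F" "card F \<le> m"
      "\<forall>S\<in>F. is_AP S \<and> S \<subseteq> X" "U - A \<subseteq> \<Union>F"
      using Suc.IH by auto
    have "card (insert A F) \<le> Suc m" using F by (simp add: card_insert_if)
    then show "\<exists>F. finite F \<and> card F \<le> Suc m \<and> (\<forall>S\<in>F. is_AP S \<and> S \<subseteq> X) \<and> U \<subseteq> \<Union>F"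
      using A F by (intro exI[of _ "insert A F"]) auto
  next
    assume "\<exists>F. finite F \<and> card F \<le> Suc m \<and> (\<forall>S\<in>F. is_AP S \<and> S \<subseteq> X) \<and> U \<subseteq> \<Union>F"
    then obtain F where F: "finite F" "card F \<le> Suc m" "\<forall>S\<in>F. is_AP S \<and> S \<subseteq> X" "U \<subseteq> \<Union>F"
      by auto
    show "AP_reach X (Suc m) U"
    proof (cases "F = {}")
      case True
      \<comment> \<open>The family is used up, but one more AP must be named and APs are nonempty; a
        singleton of \<open>X\<close> serves, which is where \<open>X \<noteq> {}\<close>
        enters.\<close>
      obtain a where "a \<in> X" using assms by auto
      then show ?thesis
        using True F is_AP_pair[of a a] Suc.IH[of "{}"] by (auto intro!: exI[of _ "{a}"])
    next
      case False
      then obtain A where A: "A \<in> F" by auto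
      then have "card (F - {A}) \<le> m" using F by simp
      then have "AP_reach X m (U - A)"
        using F A unfolding Suc.IH by (intro exI[of _ "F - {A}"]) auto
      then show ?thesis using A F by auto
    qed
  qed
qed

section \<open>Reduction to covering a few elements\<close>

lemma coverable_below_iff:
  assumes "finite X"
  shows "coverable_below X k \<longleftrightarrow>
    (\<exists>F. AP_cover F X \<and> 2 * int (card F) + (2 * k + int (card X mod 2)) \<le> int (card X))"
proof -
  have "real (card F) \<le> real (card X) / 2 - real_of_int k \<longleftrightarrow>
      2 * int (card F) + (2 * k + int (card X mod 2)) \<le> int (card X)" for F :: "int set set"
  proof -
    have "real (card F) \<le> real (card X) / 2 - real_of_int k \<longleftrightarrow>
        real_of_int (2 * int (card F) + 2 * k) \<le> real_of_int (int (card X))" by auto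
    also have "\<dots> \<longleftrightarrow> 2 * int (card F) + 2 * k \<le> int (card X)" by (simp only: of_int_le_iff)
    \<comment> \<open>The left side is even, so for odd \<open>card X\<close> the inequality is
      strict and absorbs the remainder. The resulting \<open>K\<close> has the parity of
      \<open>card X\<close>.\<close>
    also have "\<dots> \<longleftrightarrow> 2 * int (card F) + (2 * k + int (card X mod 2)) \<le> int (card X)"
      by presburger
    finally show ?thesis .
  qed
  then show ?thesis by (simp add: coverable_below_def)
qed

lemma coverable_below_nonpos:
  assumes "finite X" "2 * k + int (card X mod 2) \<le> 0"
  shows "coverable_below X k"
proof -
  obtain F where "AP_cover F X" "2 * card F \<le> card X + 1" using pair_cover[OF assms(1)] by auto
  \<comment> \<open>For odd \<open>card X\<close> the odd number \<open>2 * k + 1\<close> is at most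
    -1 and pays for the \<open>+ 1\<close>; for even \<open>card X\<close> the \<open>+ 1\<close> is
    lost to parity.\<close>
  moreover from this have "2 * int (card F) + (2 * k + int (card X mod 2)) \<le> int (card X)"
    using assms(2) by presburger
  ultimately show ?thesis using coverable_below_iff[OF assms(1)] by blast
qed

text \<open>The conjunct \<open>1 \<le> m\<close> excludes the empty \<open>X\<close>, for which
  \<open>t = 0\<close> and \<open>nat m = 0\<close> would accept \<open>U = {}\<close>.\<close>

lemma coverable_below_pos:
  assumes "finite X" "K = 2 * k + int (card X mod 2)" "1 \<le> K"
    and t: "t = min (int (card X)) (3 * K)" and m: "2 * m = t - K"
  shows "coverable_below X k \<longleftrightarrow> 1 \<le> m \<and> (\<exists>U. U \<subseteq> X \<and> card U = nat t \<and> AP_reach X (nat m) U)"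
proof -
  let ?n = "card X"
  have cov: "coverable_below X k \<longleftrightarrow> (\<exists>F. AP_cover F X \<and> 2 * int (card F) + K \<le> int ?n)"
    using coverable_below_iff[OF assms(1)] assms(2) by simp
  have fin: "finite S" if "S \<subseteq> X" for S using that assms(1) finite_subset by blast
  show ?thesis
  proof
    assume "coverable_below X k"
    then obtain F where F: "AP_cover F X" "2 * int (card F) + K \<le> int ?n" using cov by auto
    have "F \<noteq> {}"
    proof
      assume "F = {}"
      then have "X = {}" using F by (simp add: AP_cover_def)
      then show False using F(2) assms(3) by simp
    qed
    moreover have finF: "finite F" using F by (simp add: AP_cover_def)
    ultimately have pos: "1 \<le> card F" by (simp add: Suc_leI card_gt_0_iff)
    have "1 \<le> m" using pos F(2) t m assms(3) by linarith
    have X: "X \<noteq> {}" using F(2) assms(3) pos by auto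
    have "\<exists>G\<subseteq>F. card G \<le> nat m \<and> nat t \<le> card (\<Union>G)"
    proof (cases "card F \<le> nat m")
      case True
      then show ?thesis using F(1) t by (intro exI[of _ F]) (auto simp: AP_cover_def)
    next
      case False
      \<comment> \<open>If \<open>t\<close> were \<open>card X\<close>, then
        \<open>2 * m = card X - K\<close> would bound \<open>2 * card F\<close>, against the case
        assumption.\<close>
      then have K: "m = K" "t = 3 * K" using F(2) t m by linarith+
      have "\<exists>G\<subseteq>F. card G = nat K \<and> 3 * nat K \<le> card (\<Union>G)"
      proof (rule large_subfamily[OF finF])
        show "finite S" if "S \<in> F" for S using that F(1) fin by (auto simp: AP_cover_def)
        show "2 * card F + nat K \<le> card (\<Union>F)" using F assms(3) by (simp add: AP_cover_def)
        show "nat K \<le> card F" using False K by simp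
      qed
      then show ?thesis using K assms(3) by (auto simp: nat_mult_distrib)
    qed
    then obtain G where G: "G \<subseteq> F" "card G \<le> nat m" "nat t \<le> card (\<Union>G)" by auto
    have GX: "\<Union>G \<subseteq> X" using G(1) F(1) by (auto simp: AP_cover_def)
    obtain U where U: "U \<subseteq> \<Union>G" "card U = nat t" using G(3) obtain_subset_with_card_n by metis
    have "AP_reach X (nat m) U"
      unfolding AP_reach_iff[OF X] using G U F(1) finF
      by (intro exI[of _ G]) (auto simp: AP_cover_def intro: finite_subset)
    then show "1 \<le> m \<and> (\<exists>U. U \<subseteq> X \<and> card U = nat t \<and> AP_reach X (nat m) U)"
      using \<open>1 \<le> m\<close> U GX by blast
  next
    assume "1 \<le> m \<and> (\<exists>U. U \<subseteq> X \<and> card U = nat t \<and> AP_reach X (nat m) U)"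
    then obtain U where m1: "1 \<le> m" and U: "U \<subseteq> X" "card U = nat t" "AP_reach X (nat m) U" by auto
    have X: "X \<noteq> {}" using m1 m t assms(3) by auto
    obtain G where G: "finite G" "card G \<le> nat m" "\<forall>S\<in>G. is_AP S \<and> S \<subseteq> X" "U \<subseteq> \<Union>G"
      using U(3) unfolding AP_reach_iff[OF X] by auto
    have GX: "\<Union>G \<subseteq> X" using G by auto
    obtain H where H: "AP_cover H (X - \<Union>G)" "2 * card H \<le> card (X - \<Union>G) + 1"
      using pair_cover[of "X - \<Union>G"] assms(1) by auto
    have "card (X - \<Union>G) = card X - card (\<Union>G)" "card (\<Union>G) \<le> card X" "card U \<le> card (\<Union>G)"
      using GX G(4) assms(1) fin by (auto simp: card_Diff_subset intro: card_mono)
    moreover have "int (card U) = t" using U(2) t assms(3) by simp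
    ultimately have "2 * int (card H) \<le> int ?n - t + 1" using H(2) by linarith
    \<comment> \<open>As \<open>K\<close> has the parity of \<open>card X\<close>, both possible
      values of \<open>t\<close> leave an even number of elements, and pairing them loses nothing to
      rounding.\<close>
    moreover have "even (int ?n - t)" using t assms(2) by (auto simp: min_def)
    ultimately have "2 * int (card H) \<le> int ?n - t" by presburger
    moreover have "card (G \<union> H) \<le> card G + card H" by (rule card_Un_le)
    ultimately have "2 * int (card (G \<union> H)) + K \<le> int ?n" using G(2) m m1 by linarith
    moreover have "AP_cover (G \<union> H) X" using G H GX by (auto simp: AP_cover_def)
    ultimately show "coverable_below X k" using cov by blast
  qed
qed

section \<open>Picking elements along progressions\<close>

text \<open>Words may repeat a position, since a position on several progressions can be picked from
  each; the top coefficient discards such words.\<close>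

definition extend :: "nat list list \<Rightarrow> nat list \<Rightarrow> nat list list" where
  "extend L l = foldl (\<lambda>L v. L @ map ((#) v) L) L l"

lemma extend_Nil: "extend L [] = L"
  by (simp add: extend_def)

lemma extend_snoc: "extend L (l @ [v]) = extend L l @ map ((#) v) (extend L l)"
  by (simp add: extend_def)

lemma extend_sound:
  "w \<in> set (extend L l) \<Longrightarrow> \<exists>w0\<in>set L. set w0 \<subseteq> set w \<and> set w \<subseteq> set w0 \<union> set l"
proof (induction l arbitrary: w rule: rev_induct)
  case Nil
  then show ?case by (auto simp: extend_Nil)
next
  case (snoc v l)
  then consider "w \<in> set (extend L l)" | u where "w = v # u" "u \<in> set (extend L l)"
    by (auto simp: extend_snoc)
  then show ?case
  proof cases
    case 1
    then obtain w0 where "w0 \<in> set L" "set w0 \<subseteq> set w" "set w \<subseteq> set w0 \<union> set l"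
      using snoc.IH by blast
    then show ?thesis by (intro bexI[of _ w0]) auto
  next
    case 2
    then obtain w0 where "w0 \<in> set L" "set w0 \<subseteq> set u" "set u \<subseteq> set w0 \<union> set l"
      using snoc.IH by blast
    then show ?thesis using 2(1) by (intro bexI[of _ w0]) auto
  qed
qed

lemma extend_complete:
  "w \<in> set L \<Longrightarrow> distinct w \<Longrightarrow> R \<subseteq> set l \<Longrightarrow> R \<inter> set w = {} \<Longrightarrow>
     \<exists>w'\<in>set (extend L l). distinct w' \<and> set w' = set w \<union> R"
proof (induction l arbitrary: R rule: rev_induct)
  case Nil
  then show ?case by (auto simp: extend_Nil)
next
  case (snoc v l)
  \<comment> \<open>If \<open>v\<close> is wanted it is picked at this last occurrence, so the
    earlier part of \<open>l\<close> must not supply it again.\<close>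
  have "R - {v} \<subseteq> set l" "(R - {v}) \<inter> set w = {}" using snoc.prems by auto
  then obtain u where u: "u \<in> set (extend L l)" "distinct u" "set u = set w \<union> (R - {v})"
    using snoc.IH[of "R - {v}"] snoc.prems by blast
  show ?case
  proof (cases "v \<in> R")
    case True
    then have "distinct (v # u)" "set (v # u) = set w \<union> R"
      using u snoc.prems(4) by auto
    then show ?thesis using u(1) by (intro bexI[of _ "v # u"]) (auto simp: extend_snoc)
  next
    case False
    then show ?thesis using u by (intro bexI[of _ u]) (auto simp: extend_snoc)
  qed
qed

text \<open>
  \<open>ray xs i j l\<close>: the list \<open>l\<close> holds the positions of the AP that starts at \<open>xs ! i\<close> with
  difference \<open>xs ! j - xs ! i\<close>, continued as long as it stays in \<open>set xs\<close>.  The bound on the length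
  only matters if the difference is 0.
\<close>

definition ray :: "int list \<Rightarrow> nat \<Rightarrow> nat \<Rightarrow> nat list \<Rightarrow> bool" where
  "ray xs i j l \<longleftrightarrow> l \<noteq> [] \<and> set l \<subseteq> {..<length xs} \<and>
     (\<forall>s<length l. xs ! (l ! s) = xs ! i + int s * (xs ! j - xs ! i)) \<and>
     (xs ! i + int (length l) * (xs ! j - xs ! i) \<notin> set xs \<or> length xs \<le> length l)"

lemma ray_is_AP:
  assumes "ray xs i j l"
  shows "is_AP ((!) xs ` set l)" "(!) xs ` set l \<subseteq> set xs"
proof -
  let ?d = "xs ! j - xs ! i"
  have "(!) xs ` set l = (\<lambda>s. xs ! (l ! s)) ` {..<length l}"
    by (auto simp: set_conv_nth)
  also have "\<dots> = (\<lambda>s. xs ! i + int s * ?d) ` {..<length l}"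
    using assms by (intro image_cong) (auto simp: ray_def)
  also have "{..<length l} = {..length l - 1}"
    using assms by (cases l) (auto simp: ray_def)
  also have "(\<lambda>s. xs ! i + int s * ?d) ` \<dots> = {xs ! i + int s * ?d | s. s \<le> length l - 1}"
    by auto
  finally show "is_AP ((!) xs ` set l)" unfolding is_AP_def by blast
  show "(!) xs ` set l \<subseteq> set xs" using assms by (auto simp: ray_def)
qed

text \<open>An AP is an initial segment of the ray through its first two elements, so quadratically
  many rays suffice. A ray may overshoot the AP, but it is itself an AP inside the input.\<close>

lemma ray_complete:
  assumes "is_AP A" "A \<subseteq> set xs"
  shows "\<exists>i<length xs. \<exists>j<length xs. \<forall>l. ray xs i j l \<longrightarrow> A \<subseteq> (!) xs ` set l"
proof -
  obtain a d x where A: "A = {a + int s * d | s. s \<le> x}" using assms(1) by (auto simp: is_AP_def)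
  have mem: "a + int s * d \<in> set xs" if "s \<le> x" for s using that assms(2) A by auto
  obtain i where i: "i < length xs" "xs ! i = a" using mem[of 0] by (auto simp: in_set_conv_nth)
  \<comment> \<open>For \<open>x = 0\<close> the difference \<open>d\<close> is arbitrary and
    \<open>a + d\<close> may lie outside the input; difference 0 gives the same set.\<close>
  define e where "e = (if x = 0 then 0 else d)"
  have "a + e \<in> set xs" using mem[of 0] mem[of 1] by (cases "x = 0") (auto simp: e_def)
  then obtain j where j: "j < length xs" "xs ! j = a + e" by (auto simp: in_set_conv_nth)
  have Ae: "A = (\<lambda>s. a + int s * e) ` {..x}" by (auto simp: A e_def)
  have "A \<subseteq> (!) xs ` set l" if l: "ray xs i j l" for l
  proof
    fix z assume "z \<in> A"
    then obtain s where s: "z = a + int s * e" "s \<le> x" by (auto simp: Ae)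
    have nth: "xs ! (l ! r) = a + int r * e" if "r < length l" for r
      using l that i j by (simp add: ray_def)
    show "z \<in> (!) xs ` set l"
    proof (cases "s < length l")
      case True
      then show ?thesis using nth[OF True] s(1) by (intro image_eqI[of _ _ "l ! s"]) auto
    next
      case False
      \<comment> \<open>The ray stopped before \<open>A\<close> ended, so its next value is still in
        the input and it stopped by length. A nonzero difference would then give \<open>A\<close>
        more elements than \<open>xs\<close> has.\<close>
      have "a + int (length l) * e \<in> A"
        unfolding Ae by (rule image_eqI[of _ _ "length l"]) (use False s(2) in auto)
      then have "a + int (length l) * e \<in> set xs" using assms(2) by blast
      then have len: "length xs \<le> length l" using l i j by (auto simp: ray_def)
      have "e = 0"
      proof (rule ccontr)
        assume "e \<noteq> 0"
        then have "inj_on (\<lambda>s. a + int s * e) {..x}" by (auto simp: inj_on_def)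
        then have "card A = x + 1" by (simp add: Ae card_image)
        moreover have "card A \<le> length xs"
          using assms(2) card_mono[of "set xs" A] card_length[of xs] by simp
        ultimately show False using len False s(2) by simp
      qed
      moreover have "l \<noteq> []" using l by (simp add: ray_def)
      ultimately show ?thesis using nth[of 0] s(1) by (intro image_eqI[of _ _ "l ! 0"]) auto
    qed
  qed
  then show ?thesis using i(1) j(1) by blast
qed

text \<open>Soundness admits words with repetitions; completeness needs one repetition-free word per
  set, as only those show in the top coefficient.\<close>

definition reaches :: "int list \<Rightarrow> nat \<Rightarrow> nat list list \<Rightarrow> bool" where
  "reaches xs m L \<longleftrightarrow>
     (\<forall>w\<in>set L. set w \<subseteq> {..<length xs} \<and> AP_reach (set xs) m ((!) xs ` set w)) \<and>
     (\<forall>U. AP_reach (set xs) m U \<longrightarrow> U \<subseteq> set xs \<longrightarrow> (\<exists>w\<in>set L. distinct w \<and> (!) xs ` set w = U))"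

text \<open>Every ray is sound, whatever its pair, so only completeness mentions the processed pairs
  \<open>P\<close>. The list of a ray is existential because for difference 0 its length is not
  fixed.\<close>

definition collects :: "int list \<Rightarrow> nat list list \<Rightarrow> (nat \<times> nat) set \<Rightarrow> nat list list \<Rightarrow> bool" where
  "collects xs L P L' \<longleftrightarrow>
     (\<forall>w\<in>set L'. \<exists>i j l. ray xs i j l \<and> w \<in> set (extend L l)) \<and>
     (\<forall>(i, j)\<in>P. \<exists>l. ray xs i j l \<and> set (extend L l) \<subseteq> set L')"

lemma reaches_0: "reaches xs 0 [[]]"
  by (auto simp: reaches_def)

lemma collects_empty: "collects xs L {} []"
  by (simp add: collects_def)

lemma collects_append:
  "collects xs L P L' \<Longrightarrow> ray xs i j l \<Longrightarrow> collects xs L (insert (i, j) P) (L' @ extend L l)"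
  unfolding collects_def by (simp, blast)

lemma collects_reaches:
  assumes "distinct xs" "reaches xs m L" "collects xs L ({..<length xs} \<times> {..<length xs}) L'"
  shows "reaches xs (Suc m) L'"
  unfolding reaches_def
proof (intro conjI allI ballI impI)
  fix w assume "w \<in> set L'"
  then obtain i j l where l: "ray xs i j l" "w \<in> set (extend L l)"
    using assms(3) by (auto simp: collects_def)
  then obtain w0 where w0: "w0 \<in> set L" "set w \<subseteq> set w0 \<union> set l"
    using extend_sound by blast
  have r: "set w0 \<subseteq> {..<length xs}" "AP_reach (set xs) m ((!) xs ` set w0)"
    using w0(1) assms(2) by (auto simp: reaches_def)
  show "set w \<subseteq> {..<length xs}" using w0(2) r(1) l(1) by (auto simp: ray_def)
  have "AP_reach (set xs) m ((!) xs ` set w - (!) xs ` set l)"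
    using r(2) w0(2) by (rule_tac AP_reach_mono[OF r(2)]) auto
  then show "AP_reach (set xs) (Suc m) ((!) xs ` set w)" using ray_is_AP[OF l(1)] by auto
next
  fix U assume "AP_reach (set xs) (Suc m) U" "U \<subseteq> set xs"
  then obtain A where A: "is_AP A" "A \<subseteq> set xs" "AP_reach (set xs) m (U - A)" by auto
  obtain w where w: "w \<in> set L" "distinct w" "(!) xs ` set w = U - A"
    using A(3) \<open>U \<subseteq> set xs\<close> assms(2) unfolding reaches_def by (meson Diff_subset subset_trans)
  have wn: "set w \<subseteq> {..<length xs}" using w(1) assms(2) by (auto simp: reaches_def)
  obtain i j where "(i, j) \<in> {..<length xs} \<times> {..<length xs}"
    and ij: "\<And>l. ray xs i j l \<Longrightarrow> A \<subseteq> (!) xs ` set l"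
    using ray_complete[OF A(1,2)] by auto
  then obtain l where l: "ray xs i j l" "set (extend L l) \<subseteq> set L'"
    using assms(3) unfolding collects_def by blast
  \<comment> \<open>The part of \<open>U\<close> inside \<open>A\<close> is picked along the ray and
    the rest in earlier rounds, so no position is picked twice.\<close>
  define R where "R = {v \<in> set l. xs ! v \<in> U \<inter> A}"
  have "R \<inter> set w = {}" using w(3) by (auto simp: R_def)
  then obtain w' where w': "w' \<in> set (extend L l)" "distinct w'" "set w' = set w \<union> R"
    using extend_complete[OF w(1,2), of R l] by (auto simp: R_def)
  have "(!) xs ` R = U \<inter> A" using ij[OF l(1)] by (auto simp: R_def)
  then have "(!) xs ` set w' = U" using w'(3) w(3) by (auto simp: image_Un)
  then show "\<exists>w\<in>set L'. distinct w \<and> (!) xs ` set w = U" using w' l(2) by blast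
qed

text \<open>In a distinct input different positions carry different values, so the length of a
  repetition-free word is the size of its set.\<close>

lemma reaches_iff:
  assumes "distinct xs" "reaches xs m L"
  shows "(\<exists>w\<in>set L. length w = t \<and> distinct w) \<longleftrightarrow>
    (\<exists>U. U \<subseteq> set xs \<and> card U = t \<and> AP_reach (set xs) m U)"
proof -
  have card: "card ((!) xs ` set w) = length w" if "w \<in> set L" "distinct w" for w
  proof -
    have "inj_on ((!) xs) (set w)"
      using that(1) assms by (intro inj_on_nth) (auto simp: reaches_def)
    then show ?thesis using that(2) by (simp add: card_image distinct_card)
  qed
  show ?thesis
  proof
    assume "\<exists>w\<in>set L. length w = t \<and> distinct w"
    then obtain w where w: "w \<in> set L" "length w = t" "distinct w" by auto
    moreover have "set w \<subseteq> {..<length xs}" "AP_reach (set xs) m ((!) xs ` set w)"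
      using w(1) assms(2) by (auto simp: reaches_def)
    ultimately show "\<exists>U. U \<subseteq> set xs \<and> card U = t \<and> AP_reach (set xs) m U"
      using card by (intro exI[of _ "(!) xs ` set w"]) auto
  next
    assume "\<exists>U. U \<subseteq> set xs \<and> card U = t \<and> AP_reach (set xs) m U"
    then obtain U where U: "U \<subseteq> set xs" "card U = t" "AP_reach (set xs) m U" by blast
    then obtain w where "w \<in> set L" "distinct w" "(!) xs ` set w = U"
      using assms(2) unfolding reaches_def by blast
    then show "\<exists>w\<in>set L. length w = t \<and> distinct w" using card[of w] U(2) by (intro bexI[of _ w]) auto
  qed
qed

section \<open>Running times of programs\<close>

text \<open>A weakest precondition for termination that also sees the step count. By determinism it
  can be rewritten statement by statement.\<close>

definition runs :: "com \<Rightarrow> state \<Rightarrow> (nat \<Rightarrow> state \<Rightarrow> bool) \<Rightarrow> bool" where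
  "runs p s Q \<longleftrightarrow> (\<exists>t s'. exec p s t s' \<and> Q t s')"

lemma runs_mono: "runs p s Q \<Longrightarrow> (\<And>t s'. Q t s' \<Longrightarrow> R t s') \<Longrightarrow> runs p s R"
  unfolding runs_def by blast

lemma runs_exec_unique:
  assumes "\<And>t s'. exec p s t s' \<longleftrightarrow> t = T \<and> s' = u"
  shows "runs p s Q \<longleftrightarrow> Q T u"
  unfolding runs_def assms by blast

lemma runs_Skip: "runs Skip s Q \<longleftrightarrow> Q 1 s"
  by (rule runs_exec_unique) (metis exec.Skip exec_deterministic)

lemma runs_Assign: "runs (Assign i a) s Q \<longleftrightarrow> Q (1 + acost a) ((fst s)(i := aval a s), snd s)"
  by (rule runs_exec_unique) (metis exec.Assign exec_deterministic)

lemma runs_Store: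
  "runs (Store a b) s Q \<longleftrightarrow> Q (1 + acost a + acost b) (fst s, (snd s)(aval a s := aval b s))"
  by (rule runs_exec_unique) (metis exec.Store exec_deterministic)

lemma runs_Seq: "runs (Seq p q) s Q \<longleftrightarrow> runs p s (\<lambda>t s'. runs q s' (\<lambda>u. Q (t + u)))"
proof
  assume "runs (Seq p q) s Q"
  then obtain t s' where "exec (Seq p q) s t s'" "Q t s'" unfolding runs_def by blast
  then show "runs p s (\<lambda>t s'. runs q s' (\<lambda>u. Q (t + u)))"
    unfolding runs_def by (elim SeqE) blast
qed (unfold runs_def, blast intro: exec.Seq)

lemma runs_Cond:
  "runs (Cond b p q) s Q \<longleftrightarrow> runs (if bval b s then p else q) s (\<lambda>t. Q (1 + bcost b + t))"
proof (cases "bval b s")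
  case True
  show ?thesis
  proof
    assume "runs (Cond b p q) s Q"
    then obtain t s' where "exec (Cond b p q) s t s'" "Q t s'" unfolding runs_def by blast
    with True show "runs (if bval b s then p else q) s (\<lambda>t. Q (1 + bcost b + t))"
      unfolding runs_def if_P[OF True] by (elim CondE) (auto simp del: split_paired_Ex)
  qed (use True in \<open>unfold runs_def if_P[OF True], blast intro: exec.CondTrue\<close>)
next
  case False
  show ?thesis
  proof
    assume "runs (Cond b p q) s Q"
    then obtain t s' where "exec (Cond b p q) s t s'" "Q t s'" unfolding runs_def by blast
    with False show "runs (if bval b s then p else q) s (\<lambda>t. Q (1 + bcost b + t))"
      unfolding runs_def if_not_P[OF False] by (elim CondE) (auto simp del: split_paired_Ex)
  qed (use False in \<open>unfold runs_def if_not_P[OF False], blast intro: exec.CondFalse\<close>)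
qed

lemmas runs_simps = runs_Skip runs_Assign runs_Store runs_Seq runs_Cond

definition For :: "nat \<Rightarrow> aexp \<Rightarrow> com \<Rightarrow> com" where
  "For i b body =
     Seq (Assign i (Num 0))
       (While (Less (Reg i) b) (Seq body (Assign i (Add (Reg i) (Num 1)))))"

lemma runs_For:
  assumes init: "I 0 ((fst s)(i := 0), snd s)"
    and counter: "\<And>j s'. I j s' \<Longrightarrow> fst s' i = int j"
    and bound: "\<And>j s'. I j s' \<Longrightarrow> j \<le> N \<Longrightarrow> int j < aval b s' \<longleftrightarrow> j < N"
    and step: "\<And>j s'. I j s' \<Longrightarrow> j < N \<Longrightarrow>
      runs body s' (\<lambda>t s''. t \<le> Tb \<and> I (Suc j) ((fst s'')(i := fst s'' i + 1), snd s''))"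
    and final: "\<And>t s'. I N s' \<Longrightarrow> t \<le> (N + 1) * (Tb + 7 + acost b) \<Longrightarrow> Q t s'"
  shows "runs (For i b body) s Q"
proof -
  let ?W = "While (Less (Reg i) b) (Seq body (Assign i (Add (Reg i) (Num 1))))"
  \<comment> \<open>An iteration costs \<open>3 + acost b\<close> for the guard, at most
    \<open>Tb\<close> for the body and 4 for the increment. The \<open>+ 1\<close> in
    \<open>N + 1\<close> pays for the initialization, 2 steps, and the final failing guard.\<close>
  let ?c = "Tb + 7 + acost b"
  have "\<exists>t s''. exec ?W s' t s'' \<and> I N s'' \<and> t \<le> d * ?c + 3 + acost b"
    if "I j s'" "j \<le> N" "d = N - j" for d j s'
    using that
  proof (induction d arbitrary: j s')
    case 0
    then have "\<not> bval (Less (Reg i) b) s'"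
      using counter[of j s'] bound[of j s'] by simp
    then have "exec ?W s' (1 + bcost (Less (Reg i) b)) s'" by (rule exec.WhileFalse)
    moreover have "I N s'" "1 + bcost (Less (Reg i) b) \<le> 0 * ?c + 3 + acost b" using 0 by simp_all
    ultimately show ?case by blast
  next
    case (Suc d)
    then have j: "j < N" by simp
    obtain t u where t: "exec body s' t u" "t \<le> Tb" "I (Suc j) ((fst u)(i := fst u i + 1), snd u)"
      using step[OF Suc.prems(1) j] unfolding runs_def by auto
    define u' where "u' = ((fst u)(i := fst u i + 1), snd u)"
    have "exec (Assign i (Add (Reg i) (Num 1))) u 4 u'"
      using exec.Assign[of i "Add (Reg i) (Num 1)" u] by (simp add: u'_def eval_nat_numeral)
    then have body: "exec (Seq body (Assign i (Add (Reg i) (Num 1)))) s' (t + 4) u'"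
      using t(1) exec.Seq by blast
    have inv: "I (Suc j) u'" "Suc j \<le> N" "d = N - Suc j"
      using t(3) j Suc.prems(3) by (simp_all add: u'_def)
    obtain t' s'' where t': "exec ?W u' t' s''" "I N s''" "t' \<le> d * ?c + 3 + acost b"
      using Suc.IH[OF inv] by blast
    have "bval (Less (Reg i) b) s'"
      using counter[OF Suc.prems(1)] bound[OF Suc.prems(1)] j by simp
    then have "exec ?W s' (1 + bcost (Less (Reg i) b) + (t + 4) + t') s''"
      using body t'(1) by (rule exec.WhileTrue)
    moreover have "1 + bcost (Less (Reg i) b) + (t + 4) + t' \<le> Suc d * ?c + 3 + acost b"
      using t(2) t'(3) by simp
    ultimately show ?case using t'(2) by blast
  qed
  then obtain t s' where t: "exec ?W ((fst s)(i := 0), snd s) t s'" "I N s'"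
    "t \<le> N * ?c + 3 + acost b"
    using init by fastforce
  have "exec (Assign i (Num 0)) s 2 ((fst s)(i := 0), snd s)"
    using exec.Assign[of i "Num 0" s] by (simp add: eval_nat_numeral)
  then have "exec (For i b body) s (2 + t) s'"
    unfolding For_def using t(1) by (rule exec.Seq)
  moreover have "2 + t \<le> (N + 1) * ?c" using t(3) by simp
  ultimately show ?thesis using final[OF t(2)] unfolding runs_def by blast
qed

text \<open>Powers of two come from repeated doubling, as the machine has no multiplication; this is
  why the points are powers of two.\<close>

definition double :: "nat \<Rightarrow> nat \<Rightarrow> aexp \<Rightarrow> com" where
  "double l r b = For l b (Assign r (Add (Reg r) (Reg r)))"

lemma runs_double:
  assumes "l \<noteq> r" "\<And>f. (\<And>x. x \<noteq> l \<Longrightarrow> x \<noteq> r \<Longrightarrow> f x = fst s x) \<Longrightarrow> aval b (f, snd s) = int N"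
  shows "runs (double l r b) s (\<lambda>t s'. t \<le> (N + 1) * (11 + acost b) \<and>
    s' = ((fst s)(r := fst s r * 2 ^ N, l := int N), snd s))"
  unfolding double_def
proof (rule runs_For[where N = N and Tb = 4 and
      I = "\<lambda>j s'. s' = ((fst s)(r := fst s r * 2 ^ j, l := int j), snd s)"])
  show "int j < aval b s' \<longleftrightarrow> j < N"
    if "s' = ((fst s)(r := fst s r * 2 ^ j, l := int j), snd s)" for j s'
    using assms(2)[of "fst s'"] that by simp
qed (use assms(1) in \<open>auto simp: runs_simps fun_eq_iff\<close>)

text \<open>Four arrays are interleaved at the negative addresses, so that they never overwrite the input.\<close>

definition cell :: "nat \<Rightarrow> nat \<Rightarrow> int" where
  "cell c M = - 1 - int c - 4 * int M"

definition arr :: "state \<Rightarrow> nat \<Rightarrow> nat \<Rightarrow> int" where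
  "arr s c M = snd s (cell c M)"

text \<open>The multiple \<open>4 * e\<close> is formed by additions, so \<open>e\<close> is
  evaluated four times.\<close>

definition cell_at :: "nat \<Rightarrow> aexp \<Rightarrow> aexp" where
  "cell_at c e = Sub (Num (- 1 - int c)) (Add (Add e e) (Add e e))"

lemma cell_eq_iff: "c < 4 \<Longrightarrow> c' < 4 \<Longrightarrow> cell c M = cell c' M' \<longleftrightarrow> c = c' \<and> M = M'"
  unfolding cell_def by presburger

lemma cell_neg: "cell c M < 0"
  unfolding cell_def by simp

lemma aval_cell_at: "aval e s = int M \<Longrightarrow> aval (cell_at c e) s = cell c M"
  by (simp add: cell_at_def cell_def)

lemma acost_cell_at: "acost (cell_at c e) = 5 + 4 * acost e"
  by (simp add: cell_at_def)

definition keeps :: "nat set \<Rightarrow> state \<Rightarrow> state \<Rightarrow> bool" where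
  "keeps R s s' \<longleftrightarrow> (\<forall>r. r \<notin> R \<longrightarrow> fst s' r = fst s r)"

lemma keepsD: "keeps R s s' \<Longrightarrow> r \<notin> R \<Longrightarrow> fst s' r = fst s r"
  by (simp add: keeps_def)

abbreviation (input) "reg_n \<equiv> 0 :: nat"
abbreviation (input) "reg_k \<equiv> 1 :: nat"
abbreviation (input) "reg_half \<equiv> 2 :: nat"
abbreviation (input) "reg_K \<equiv> 3 :: nat"
abbreviation (input) "reg_T \<equiv> 4 :: nat"
abbreviation (input) "reg_S \<equiv> 5 :: nat"
abbreviation (input) "reg_m \<equiv> 6 :: nat"
abbreviation (input) "reg_o \<equiv> 7 :: nat"
abbreviation (input) "reg_i \<equiv> 8 :: nat"
abbreviation (input) "reg_j \<equiv> 9 :: nat"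
abbreviation (input) "reg_cur \<equiv> 10 :: nat"
abbreviation (input) "reg_d \<equiv> 11 :: nat"
abbreviation (input) "reg_r \<equiv> 12 :: nat"
abbreviation (input) "reg_v \<equiv> 13 :: nat"
abbreviation (input) "reg_c \<equiv> 14 :: nat"
abbreviation (input) "reg_M \<equiv> 15 :: nat"
abbreviation (input) "reg_acc \<equiv> 16 :: nat"
abbreviation (input) "reg_rest \<equiv> 17 :: nat"
abbreviation (input) "reg_sign \<equiv> 18 :: nat"
abbreviation (input) "reg_a \<equiv> 19 :: nat"
abbreviation (input) "reg_p \<equiv> 20 :: nat"
abbreviation (input) "reg_l \<equiv> 21 :: nat"

section \<open>One coefficient of a wedge product\<close>

definition wedge_bit :: "nat \<Rightarrow> com" where
  "wedge_bit src =
     Seq (double reg_l reg_acc (Reg reg_c))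
    (Seq (Assign reg_p (Num 1))
    (Seq (double reg_l reg_p (Sub (Sub (Reg reg_T) (Num 1)) (Reg reg_a)))
    (Cond (Less (Reg reg_rest) (Reg reg_p)) Skip
      (Seq (Cond (Less (Num 0) (Reg reg_sign))
             (Assign reg_acc (Add (Reg reg_acc) (Mem (cell_at src (Sub (Reg reg_M) (Reg reg_p))))))
             (Assign reg_acc (Sub (Reg reg_acc) (Mem (cell_at src (Sub (Reg reg_M) (Reg reg_p)))))))
      (Seq (Assign reg_rest (Sub (Reg reg_rest) (Reg reg_p)))
        (Assign reg_sign (Sub (Num 0) (Reg reg_sign))))))))"

text \<open>Horner's rule: the weights are powers of \<open>2 ^ c\<close>, where \<open>c\<close> is the content of \<open>reg_c\<close>.\<close>

definition wedge_cell :: "nat \<Rightarrow> com" where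
  "wedge_cell src =
     Seq (Assign reg_acc (Num 0))
    (Seq (Assign reg_rest (Reg reg_M))
    (Seq (Assign reg_sign (Num 1))
      (For reg_a (Reg reg_T) (wedge_bit src))))"

text \<open>After \<open>j\<close> bits from the top, \<open>R\<close> is the unread part of the
  mask and \<open>M - R\<close> the part read, whose set bits determine the sign. The accumulator
  still lacks the factor \<open>(2 ^ c) ^ (T - j)\<close>. For \<open>j = T\<close> the recursive
  term is 0 and the accumulator is the coefficient.\<close>

definition wedge_inv :: "nat \<Rightarrow> nat \<Rightarrow> nat \<Rightarrow> nat \<Rightarrow> state \<Rightarrow> nat \<Rightarrow> state \<Rightarrow> bool" where
  "wedge_inv src T c M s j s' \<longleftrightarrow>
     keeps {reg_acc..reg_l} s s' \<and> snd s' = snd s \<and>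
     (\<exists>R. fst s' reg_rest = int R \<and> R < 2 ^ (T - j) \<and> R \<le> M \<and>
       (fst s' reg_sign = 1 \<or> fst s' reg_sign = - 1) \<and>
       wedge T (2 ^ c) (arr s src) M = fst s' reg_acc * (2 ^ c) ^ (T - j) +
         fst s' reg_sign * wedge (T - j) (2 ^ c) (\<lambda>A. arr s src (A + (M - R))) R)"

lemma runs_wedge_bit:
  assumes s: "fst s reg_T = int T" "fst s reg_M = int M" "fst s reg_c = int c"
    and B: "T + 1 \<le> B" "c + 1 \<le> B"
    and I: "wedge_inv src T c M s j s'" "j < T" "fst s' reg_a = int j"
  shows "runs (wedge_bit src) s' (\<lambda>t s''. t \<le> 80 * B \<and> wedge_inv src T c M s (Suc j) s'' \<and>
     fst s'' reg_a = int j)"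
proof -
  define a where "a = T - Suc j"
  have a: "T - j = Suc a" "Suc j + a = T" using I(2) by (auto simp: a_def)
  from I(1) obtain R where k: "keeps {reg_acc..reg_l} s s'" and mem: "snd s' = snd s"
    and R: "fst s' reg_rest = int R" "R < 2 ^ Suc a" "R \<le> M"
    and sign: "fst s' reg_sign = 1 \<or> fst s' reg_sign = - 1"
    and w: "wedge T (2 ^ c) (arr s src) M = fst s' reg_acc * (2 ^ c) ^ Suc a +
         fst s' reg_sign * wedge (Suc a) (2 ^ c) (\<lambda>A. arr s src (A + (M - R))) R"
    unfolding wedge_inv_def a by blast
  have k': "fst s' reg_T = int T" "fst s' reg_M = int M" "fst s' reg_c = int c"
    using s keepsD[OF k, of reg_T] keepsD[OF k, of reg_M] keepsD[OF k, of reg_c] by auto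
  \<comment> \<open>The state after both doublings: the accumulator is scaled by the Horner factor
    and \<open>reg_p\<close> holds the weight of the current bit.\<close>
  define s1 where "s1 = ((fst s')(reg_acc := fst s' reg_acc * 2 ^ c, reg_l := int a,
     reg_p := 2 ^ a), snd s)"
  have inv: "wedge_inv src T c M s (Suc j) u" if "keeps {reg_acc..reg_l} s u" "snd u = snd s"
    "fst u reg_rest = int R'" "R' < 2 ^ a" "R' \<le> M" "fst u reg_sign = 1 \<or> fst u reg_sign = - 1"
    "wedge T (2 ^ c) (arr s src) M = fst u reg_acc * (2 ^ c) ^ a +
         fst u reg_sign * wedge a (2 ^ c) (\<lambda>A. arr s src (A + (M - R'))) R'" for u R'
    unfolding wedge_inv_def a_def[symmetric] using that by blast
  have cond: "runs (Cond (Less (Reg reg_rest) (Reg reg_p)) Skip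
      (Seq (Cond (Less (Num 0) (Reg reg_sign))
             (Assign reg_acc (Add (Reg reg_acc) (Mem (cell_at src (Sub (Reg reg_M) (Reg reg_p))))))
             (Assign reg_acc (Sub (Reg reg_acc) (Mem (cell_at src (Sub (Reg reg_M) (Reg reg_p)))))))
      (Seq (Assign reg_rest (Sub (Reg reg_rest) (Reg reg_p)))
        (Assign reg_sign (Sub (Num 0) (Reg reg_sign)))))) s1
     (\<lambda>t s''. t \<le> 50 \<and> wedge_inv src T c M s (Suc j) s'' \<and> fst s'' reg_a = int j)" (is "runs ?C s1 _")
  proof (cases "R < 2 ^ a")
    case True
    then have "int R < 2 ^ a" by (metis of_nat_less_iff of_nat_numeral of_nat_power)
    moreover have "wedge_inv src T c M s (Suc j) s1"
      using k R(1,3) True sign w by (intro inv[of _ R]) (auto simp: s1_def keeps_def algebra_simps)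
    ultimately show ?thesis using R(1) I(3) by (simp add: runs_simps s1_def)
  next
    case False
    \<comment> \<open>The bit is set: its term is the coefficient at \<open>M\<close> without this
      bit, and the sign flips for the lower bits.\<close>
    define y where "y = arr s src (M - 2 ^ a)"
    define s2 where "s2 = ((fst s1)(reg_acc := fst s1 reg_acc + fst s' reg_sign * y,
      reg_rest := int (R - 2 ^ a), reg_sign := - fst s' reg_sign), snd s)"
    have le: "2 ^ a \<le> R" "2 ^ a \<le> M" using False R(3) by auto
    have "\<not> int R < 2 ^ a" using False by (metis of_nat_less_iff of_nat_numeral of_nat_power)
    moreover have "snd s1 (aval (cell_at src (Sub (Reg reg_M) (Reg reg_p))) s1) = y"
    proof -
      have "aval (Sub (Reg reg_M) (Reg reg_p)) s1 = int (M - 2 ^ a)"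
        using le k' by (simp add: s1_def of_nat_diff)
      then show ?thesis by (simp add: aval_cell_at y_def arr_def s1_def)
    qed
    moreover have "wedge_inv src T c M s (Suc j) s2"
    proof (rule inv[of _ "R - 2 ^ a"])
      have e: "R + (M - R) = M" "M - (R - 2 ^ a) = M - R + 2 ^ a"
        using le R(3) by auto
      show "wedge T (2 ^ c) (arr s src) M = fst s2 reg_acc * (2 ^ c) ^ a +
         fst s2 reg_sign * wedge a (2 ^ c) (\<lambda>A. arr s src (A + (M - (R - 2 ^ a)))) (R - 2 ^ a)"
        using False unfolding w by (simp add: s2_def s1_def e y_def algebra_simps)
      show "R - 2 ^ a < 2 ^ a" using R(2) le by auto
    qed (use k R sign in \<open>auto simp: s2_def s1_def keeps_def\<close>)
    moreover have "s2 = ((fst s1)(reg_acc := fst s1 reg_acc + fst s' reg_sign * y,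
      reg_rest := int R - 2 ^ a, reg_sign := - fst s' reg_sign), snd s)"
      using le by (simp add: s2_def of_nat_diff)
    moreover have "fst s2 reg_a = int j" using I(3) by (simp add: s2_def s1_def)
    ultimately show ?thesis
      using R(1) sign by (auto simp: runs_simps acost_cell_at s1_def fun_upd_twist)
  qed
  show ?thesis
    unfolding wedge_bit_def runs_Seq runs_Assign
  proof (rule runs_mono[OF runs_double[where N = c]])
    show "aval (Reg reg_c) (f, snd s') = int c"
      if "\<And>x. x \<noteq> reg_l \<Longrightarrow> x \<noteq> reg_acc \<Longrightarrow> f x = fst s' x" for f
      using that k' by simp
    fix t u
    assume "t \<le> (c + 1) * (11 + acost (Reg reg_c)) \<and>
      u = ((fst s')(reg_acc := fst s' reg_acc * 2 ^ c, reg_l := int c), snd s')"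
    then have t: "t \<le> (c + 1) * 12"
      and u: "u = ((fst s')(reg_acc := fst s' reg_acc * 2 ^ c, reg_l := int c), snd s')" by auto
    show "runs (double reg_l reg_p (Sub (Sub (Reg reg_T) (Num 1)) (Reg reg_a)))
        ((fst u)(reg_p := aval (Num 1) u), snd u)
        (\<lambda>t' s'. runs ?C s' (\<lambda>u s''. t + (1 + acost (Num 1) + (t' + u)) \<le> 80 * B \<and>
          wedge_inv src T c M s (Suc j) s'' \<and> fst s'' reg_a = int j))"
    proof (rule runs_mono[OF runs_double[where N = a]])
      show "aval (Sub (Sub (Reg reg_T) (Num 1)) (Reg reg_a))
          (f, snd ((fst u)(reg_p := aval (Num 1) u), snd u)) = int a"
        if "\<And>x. x \<noteq> reg_l \<Longrightarrow> x \<noteq> reg_p \<Longrightarrow>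
          f x = fst ((fst u)(reg_p := aval (Num 1) u), snd u) x" for f
        using that k' I(3) a by (simp add: u)
      fix t' u'
      assume "t' \<le> (a + 1) * (11 + acost (Sub (Sub (Reg reg_T) (Num 1)) (Reg reg_a))) \<and>
        u' = ((fst ((fst u)(reg_p := aval (Num 1) u), snd u))
          (reg_p := fst ((fst u)(reg_p := aval (Num 1) u), snd u) reg_p * 2 ^ a, reg_l := int a),
          snd ((fst u)(reg_p := aval (Num 1) u), snd u))"
      then have t': "t' \<le> (a + 1) * 16" and "u' = s1"
        by (auto simp: u s1_def mem fun_eq_iff)
      \<comment> \<open>The doublings take at most \<open>28 * B\<close> steps and everything else
        at most 52.\<close>
      moreover have "(c + 1) * 12 \<le> B * 12" "(a + 1) * 16 \<le> B * 16"
        using a B by (intro mult_right_mono; simp)+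
      ultimately show "runs ?C u' (\<lambda>u s''. t + (1 + acost (Num 1) + (t' + u)) \<le> 80 * B \<and>
          wedge_inv src T c M s (Suc j) s'' \<and> fst s'' reg_a = int j)"
        using t B by (auto intro!: runs_mono[OF cond])
    qed simp
  qed simp
qed

lemma runs_wedge_cell:
  assumes s: "fst s reg_T = int T" "fst s reg_M = int M" "fst s reg_c = int c" "M < 2 ^ T"
    and B: "T + 1 \<le> B" "c + 1 \<le> B"
  shows "runs (wedge_cell src) s (\<lambda>t s'. t \<le> 100 * B\<^sup>2 \<and> keeps {reg_acc..reg_l} s s' \<and>
     snd s' = snd s \<and> fst s' reg_acc = wedge T (2 ^ c) (arr s src) M)"
  unfolding wedge_cell_def runs_Seq runs_Assign
proof (rule runs_For[where N = T and Tb = "80 * B" and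
      I = "\<lambda>j s'. wedge_inv src T c M s j s' \<and> fst s' reg_a = int j"], goal_cases)
  case 1
  show ?case
    using s by (auto simp: wedge_inv_def keeps_def)
next
  case (3 j s')
  then show ?case using s(1) keepsD[of _ s s' reg_T] by (auto simp: wedge_inv_def)
next
  case (4 j s')
  have "wedge_inv src T c M s (Suc j) (u(reg_a := z), m)" if "wedge_inv src T c M s (Suc j) (u, m)" for u m z
    using that by (auto simp: wedge_inv_def keeps_def)
  then show ?case
    using 4 by (intro runs_mono[OF runs_wedge_bit[OF s(1-3) B, of src j s']]) auto
next
  case (5 t s')
  have "(T + 1) * (80 * B + 7 + acost (Reg reg_T)) \<le> B * (88 * B)"
    using B by (intro mult_mono) auto
  moreover have "B \<le> B\<^sup>2" using B by (simp add: power2_eq_square)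
  ultimately show ?case using 5 B by (auto simp: wedge_inv_def power2_eq_square)
qed auto

section \<open>Tables of coefficients\<close>

definition frame :: "nat set \<Rightarrow> state \<Rightarrow> state \<Rightarrow> bool" where
  "frame D s s' \<longleftrightarrow> (\<forall>z. (\<forall>c\<in>D. \<forall>M. z \<noteq> cell c M) \<longrightarrow> snd s' z = snd s z)"

lemma frame_trans: "frame D s s' \<Longrightarrow> frame D s' s'' \<Longrightarrow> frame D s s''"
  by (auto simp: frame_def)

lemma frame_mono: "frame D s s' \<Longrightarrow> D \<subseteq> D' \<Longrightarrow> frame D' s s'"
  unfolding frame_def by blast

lemma frame_arr:
  assumes "frame D s s'" "D \<subseteq> {..<4}" "c < 4" "c \<notin> D"
  shows "arr s' c = arr s c"
proof
  fix M
  have "cell c M \<noteq> cell d M'" if "d \<in> D" for d M'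
    using that assms(2-4) by (subst cell_eq_iff) auto
  then show "arr s' c M = arr s c M" using assms(1) unfolding frame_def arr_def by blast
qed

lemma frame_input: "frame D s s' \<Longrightarrow> snd s' (int j) = snd s (int j)"
proof -
  have "int j \<noteq> cell c M" for c M using cell_neg[of c M] by linarith
  then show "frame D s s' \<Longrightarrow> ?thesis" unfolding frame_def by blast
qed

text \<open>Constant overhead is absorbed into the leading constant, so each loop level merely
  multiplies the bound by \<open>B\<close>.\<close>

lemma for_time:
  fixes N B Y a b :: nat
  assumes "N + 1 \<le> B" "1 \<le> Y"
  shows "(N + 1) * (a * Y + b) \<le> (a + b) * (B * Y)"
proof -
  have "(N + 1) * (a * Y + b) \<le> B * (a * Y + b * Y)"
    using assms by (intro mult_mono add_mono) auto
  then show ?thesis by (simp add: algebra_simps)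
qed

definition fill :: "nat \<Rightarrow> com \<Rightarrow> aexp \<Rightarrow> com" where
  "fill dst p e = For reg_M (Reg reg_S) (Seq p (Store (cell_at dst (Reg reg_M)) e))"

text \<open>The body may assume that the cell about to be written still has its old value, which
  allows adding to an array in place.\<close>

lemma runs_fill:
  assumes dst: "dst < 4" and S: "fst s reg_S = int S" and R: "reg_M \<in> R" "reg_S \<notin> R"
    and body: "\<And>s' M. keeps R s s' \<Longrightarrow> frame {dst} s s' \<Longrightarrow> fst s' reg_M = int M \<Longrightarrow> M < S \<Longrightarrow>
      arr s' dst M = arr s dst M \<Longrightarrow>
      runs p s' (\<lambda>t s''. t \<le> Tp \<and> keeps (R - {reg_M}) s' s'' \<and> snd s'' = snd s' \<and> aval e s'' = G M)"
  shows "runs (fill dst p e) s (\<lambda>t s'. t \<le> (S + 1) * (Tp + acost e + 18) \<and> keeps R s s' \<and>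
    frame {dst} s s' \<and> (\<forall>M<S. arr s' dst M = G M))"
  unfolding fill_def
proof (rule runs_For[where N = S and Tb = "Tp + acost e + 10" and
    I = "\<lambda>j s'. keeps R s s' \<and> frame {dst} s s' \<and> fst s' reg_M = int j \<and>
      (\<forall>M. arr s' dst M = (if M < j then G M else arr s dst M))"], goal_cases)
  case 1
  show ?case using R by (simp add: keeps_def frame_def arr_def)
next
  case (3 j s')
  then show ?case using S R by (simp add: keeps_def)
next
  case (4 j s')
  show ?case
    unfolding runs_Seq
  proof (rule runs_mono[OF body[of s' j]])
    fix t s''
    assume *: "t \<le> Tp \<and> keeps (R - {reg_M}) s' s'' \<and> snd s'' = snd s' \<and> aval e s'' = G j"
    then have M: "aval (cell_at dst (Reg reg_M)) s'' = cell dst j"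
      using 4 by (simp add: aval_cell_at keeps_def)
    have "arr (f, (snd s'')(cell dst j := G j)) dst M = (if M < Suc j then G M else arr s dst M)" for f M
      using 4 * dst cell_eq_iff[of dst dst M j] by (auto simp: arr_def less_Suc_eq)
    moreover have "frame {dst} s (f, (snd s'')(cell dst j := G j))" for f
      using 4 * by (auto simp: frame_def)
    ultimately show "runs (Store (cell_at dst (Reg reg_M)) e) s''
        (\<lambda>u s'. t + u \<le> Tp + acost e + 10 \<and> keeps R s ((fst s')(reg_M := fst s' reg_M + 1), snd s') \<and>
          frame {dst} s ((fst s')(reg_M := fst s' reg_M + 1), snd s') \<and>
          fst ((fst s')(reg_M := fst s' reg_M + 1), snd s') reg_M = int (Suc j) \<and>
          (\<forall>M. arr ((fst s')(reg_M := fst s' reg_M + 1), snd s') dst M =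
            (if M < Suc j then G M else arr s dst M)))"
      unfolding runs_Store M using 4 * R by (auto simp: acost_cell_at keeps_def)
  qed (use 4 in auto)
next
  case (5 t s')
  then show ?case by (simp add: algebra_simps)
qed auto

lemma runs_fill_simple:
  assumes dst: "dst < 4" and S: "fst s reg_S = int S" "1 \<le> S" and e: "acost e \<le> 21"
    and body: "\<And>s' M. frame {dst} s s' \<Longrightarrow> fst s' reg_M = int M \<Longrightarrow> M < S \<Longrightarrow>
      arr s' dst M = arr s dst M \<Longrightarrow> aval e s' = G M"
  shows "runs (fill dst Skip e) s (\<lambda>t s'. t \<le> 80 * S \<and> keeps {reg_M} s s' \<and>
    frame {dst} s s' \<and> (\<forall>M<S. arr s' dst M = G M))"
proof (rule runs_mono[OF runs_fill[where R = "{reg_M}" and Tp = 1 and G = G, OF dst S(1)]])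
  fix t s'
  assume *: "t \<le> (S + 1) * (1 + acost e + 18) \<and> keeps {reg_M} s s' \<and> frame {dst} s s' \<and>
    (\<forall>M<S. arr s' dst M = G M)"
  have "(S + 1) * (1 + acost e + 18) \<le> (2 * S) * 40" using S(2) e by (intro mult_mono) auto
  then show "t \<le> 80 * S \<and> keeps {reg_M} s s' \<and> frame {dst} s s' \<and> (\<forall>M<S. arr s' dst M = G M)"
    using * by auto
qed (use body in \<open>auto simp: runs_simps keeps_def\<close>)

definition array_at :: "nat \<Rightarrow> aexp" where
  "array_at c = Mem (cell_at c (Reg reg_M))"

lemma aval_array_at: "fst s reg_M = int M \<Longrightarrow> aval (array_at c) s = arr s c M"
  by (simp add: array_at_def aval_cell_at arr_def)

lemma acost_array_at: "acost (array_at c) = 10"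
  by (simp add: array_at_def acost_cell_at)

definition wedge_table :: "nat \<Rightarrow> nat \<Rightarrow> aexp \<Rightarrow> com" where
  "wedge_table src dst e = fill dst (wedge_cell src) (Add e (Reg reg_acc))"

lemma runs_wedge_table:
  assumes "src < 4" "dst < 4" "src \<noteq> dst"
    and s: "fst s reg_T = int T" "fst s reg_S = 2 ^ T" "fst s reg_c = int c"
    and B: "T + 1 \<le> B" "c + 1 \<le> B"
    and e: "acost e \<le> 10"
      "\<And>s' M. fst s' reg_M = int M \<Longrightarrow> arr s' dst M = arr s dst M \<Longrightarrow> aval e s' = h M"
  shows "runs (wedge_table src dst e) s (\<lambda>t s'. t \<le> 260 * (2 ^ T * B\<^sup>2) \<and> keeps {reg_M..reg_l} s s' \<and>
    frame {dst} s s' \<and> (\<forall>M<2 ^ T. arr s' dst M = h M + wedge T (2 ^ c) (arr s src) M))"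
  unfolding wedge_table_def
proof (rule runs_mono[OF runs_fill[where S = "2 ^ T" and R = "{reg_M..reg_l}" and Tp = "100 * B\<^sup>2" and
      G = "\<lambda>M. h M + wedge T (2 ^ c) (arr s src) M"]], goal_cases)
  case (5 s' M)
  then have k: "fst s' reg_T = int T" "fst s' reg_c = int c"
    using s keepsD[OF 5(1), of reg_T] keepsD[OF 5(1), of reg_c] by auto
  \<comment> \<open>A coefficient of the product reads many source cells; these are intact because
    the writes go to another array.\<close>
  have src: "arr s' src = arr s src" using 5(2) assms(1-3) by (intro frame_arr[of "{dst}"]) auto
  show ?case
  proof (rule runs_mono[OF runs_wedge_cell[OF k(1) 5(3) k(2) 5(4) B, of src]])
    fix t s''
    assume *: "t \<le> 100 * B\<^sup>2 \<and> keeps {reg_acc..reg_l} s' s'' \<and> snd s'' = snd s' \<and>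
      fst s'' reg_acc = wedge T (2 ^ c) (arr s' src) M"
    then have "keeps ({reg_M..reg_l} - {reg_M}) s' s''" by (auto simp: keeps_def)
    moreover have "fst s'' reg_M = int M" using * 5(3) by (auto simp: keeps_def)
    then have "aval e s'' = h M" using * 5(5) by (intro e(2)) (auto simp: arr_def)
    ultimately show "t \<le> 100 * B\<^sup>2 \<and> keeps ({reg_M..reg_l} - {reg_M}) s' s'' \<and> snd s'' = snd s' \<and>
      aval (Add e (Reg reg_acc)) s'' = h M + wedge T (2 ^ c) (arr s src) M"
      using * src by simp
  qed
next
  case (6 t s')
  have B2: "1 \<le> B\<^sup>2" using B by simp
  have "(2 ^ T + 1) * (100 * B\<^sup>2 + acost (Add e (Reg reg_acc)) + 18) \<le> (2 * 2 ^ T) * (130 * B\<^sup>2)"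
    using e(1) B2 by (intro mult_mono) auto
  then show ?case using 6 by simp
qed (use assms in auto)

text \<open>The two factors of the bivector are multiplied in turn, with array 3 for the
  intermediate product; the second pass adds the old table, that is, the words that skip
  \<open>v\<close>.\<close>

definition pick :: com where
  "pick =
     Seq (Assign reg_c (Add (Reg reg_v) (Reg reg_v)))
    (Seq (wedge_table 2 3 (Num 0))
    (Seq (Assign reg_c (Add (Reg reg_c) (Num 1)))
    (Seq (wedge_table 3 2 (array_at 2))
      (Assign reg_cur (Add (Reg reg_cur) (Reg reg_d))))))"

lemma runs_pick:
  assumes s: "fst s reg_T = int T" "fst s reg_S = 2 ^ T" "fst s reg_v = int v"
    and B: "T + 1 \<le> B" "2 * v + 2 \<le> B"
    and L: "\<And>M. M < 2 ^ T \<Longrightarrow> arr s 2 M = table T L M"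
  shows "runs pick s (\<lambda>t s'. t \<le> 540 * (2 ^ T * B\<^sup>2) \<and>
    keeps (insert reg_cur {reg_c..reg_l}) s s' \<and> frame {2, 3} s s' \<and>
    fst s' reg_cur = fst s reg_cur + fst s reg_d \<and>
    (\<forall>M<2 ^ T. arr s' 2 M = table T (L @ map ((#) v) L) M))"
  unfolding pick_def runs_Seq runs_Assign
proof (rule runs_mono[OF runs_wedge_table[where T = T and B = B and c = "2 * v" and h = "\<lambda>_. 0"]], goal_cases)
  case (11 t1 s1)
  let ?s0 = "((fst s)(reg_c := aval (Add (Reg reg_v) (Reg reg_v)) s), snd s)"
  have t1: "t1 \<le> 260 * (2 ^ T * B\<^sup>2)" and k1: "keeps {reg_M..reg_l} ?s0 s1"
    and f1: "frame {3} ?s0 s1"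
    and w1: "\<And>M. M < 2 ^ T \<Longrightarrow> arr s1 3 M = wedge T (2 ^ (2 * v)) (arr ?s0 2) M"
    using 11 by auto
  have r1: "keeps {reg_c..reg_l} s s1" "fst s1 reg_c = 2 * int v" "frame {3} s s1"
    using k1 f1 s by (auto simp: keeps_def frame_def)
  have r2: "fst s1 reg_T = int T" "fst s1 reg_S = 2 ^ T"
    using s keepsD[OF r1(1), of reg_T] keepsD[OF r1(1), of reg_S] by auto
  have g1: "arr s1 2 = arr s 2" using r1(3) by (rule frame_arr) auto
  have h1: "arr s1 3 M = wedge T (2 ^ (2 * v)) (table T L) M" if "M < 2 ^ T" for M
    unfolding w1[OF that] by (rule wedge_cong[OF that]) (use L in \<open>simp add: arr_def\<close>)
  show ?case
  proof (rule runs_mono[OF runs_wedge_table[where T = T and B = B and c = "2 * v + 1" and h = "arr s 2"]],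
      goal_cases)
    case (11 t2 s2)
    let ?s1 = "((fst s1)(reg_c := aval (Add (Reg reg_c) (Num 1)) s1), snd s1)"
    have t2: "t2 \<le> 260 * (2 ^ T * B\<^sup>2)" and k2: "keeps {reg_M..reg_l} ?s1 s2"
      and f2: "frame {2} ?s1 s2"
      and w2: "\<And>M. M < 2 ^ T \<Longrightarrow> arr s2 2 M = arr s 2 M + wedge T (2 ^ (2 * v + 1)) (arr ?s1 3) M"
      using 11 by auto
    have k: "keeps {reg_c..reg_l} s s2" using r1(1) k2 by (auto simp: keeps_def)
    have f: "frame {2, 3} s s2"
    proof (rule frame_trans)
      show "frame {2, 3} s s1" using r1(3) by (rule frame_mono) auto
      show "frame {2, 3} s1 s2" using f2 by (auto simp: frame_def)
    qed
    have w: "arr s2 2 M = table T (L @ map ((#) v) L) M" if "M < 2 ^ T" for M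
    proof -
      have "wedge T (2 ^ (2 * v + 1)) (arr ?s1 3) M
          = wedge T (2 ^ (2 * v + 1)) (wedge T (2 ^ (2 * v)) (table T L)) M"
        by (rule wedge_cong[OF that]) (use h1 in \<open>simp add: arr_def\<close>)
      then show ?thesis using w2[OF that] L[OF that] by (simp only: table_extend)
    qed
    define u where "u = ((fst s2)(reg_cur := fst s2 reg_cur + fst s2 reg_d), snd s2)"
    have "keeps (insert reg_cur {reg_c..reg_l}) s u" using k by (simp add: u_def keeps_def)
    moreover have "frame {2, 3} s u" using f by (simp add: u_def frame_def)
    moreover have "fst u reg_cur = fst s reg_cur + fst s reg_d"
      using keepsD[OF k, of reg_cur] keepsD[OF k, of reg_d] by (simp add: u_def)
    moreover have "arr u 2 = arr s2 2" by (simp add: arr_def u_def fun_eq_iff)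
    moreover obtain Y where Y: "Y = 2 ^ T * B\<^sup>2" by simp
    then have "1 \<le> Y" using B(1) by simp
    then have "1 + acost (Add (Reg reg_v) (Reg reg_v)) + (t1 + (1 + acost (Add (Reg reg_c) (Num 1)) +
        (t2 + (1 + acost (Add (Reg reg_cur) (Reg reg_d)))))) \<le> 540 * (2 ^ T * B\<^sup>2)"
      using t1 t2 unfolding Y[symmetric] by simp
    ultimately show ?case
      unfolding u_def[unfolded aval.simps, symmetric] aval.simps using w by simp
  next
    case (10 s' M)
    then show ?case by (simp add: aval_array_at) (simp add: arr_def g1[unfolded arr_def fun_eq_iff])
  qed (use r1 r2 B in \<open>simp_all add: acost_array_at\<close>)
qed (use s B in simp_all)

section \<open>Walking along a progression\<close>

definition ready :: "int list \<Rightarrow> nat \<Rightarrow> state \<Rightarrow> bool" where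
  "ready xs T s \<longleftrightarrow> fst s reg_n = int (length xs) \<and> fst s reg_T = int T \<and> fst s reg_S = 2 ^ T \<and>
     (\<forall>j<length xs. snd s (int j) = xs ! j)"

lemma ready_transfer:
  "ready xs T s \<Longrightarrow> keeps R s s' \<Longrightarrow> R \<inter> {reg_n, reg_T, reg_S} = {} \<Longrightarrow> frame D s s' \<Longrightarrow> ready xs T s'"
  unfolding ready_def using frame_input[of D s s'] by (auto simp: keeps_def)

lemma frame_update: "frame D s (f, snd s') \<longleftrightarrow> frame D s s'"
  by (simp add: frame_def)

lemma arr_update: "arr (f, snd s) = arr s"
  by (simp add: arr_def fun_eq_iff)

definition scan_step :: com where
  "scan_step =
     Cond (Conj (Neg (Less (Mem (Reg reg_v)) (Reg reg_cur))) (Neg (Less (Reg reg_cur) (Mem (Reg reg_v)))))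
       pick Skip"

text \<open>There is no loop exit: once the progression has left the input, no comparison succeeds.\<close>

definition scan :: com where
  "scan = For reg_r (Reg reg_n) (For reg_v (Reg reg_n) scan_step)"

definition scanned :: "int list \<Rightarrow> nat \<Rightarrow> nat list list \<Rightarrow> int \<Rightarrow> int \<Rightarrow> state \<Rightarrow> nat list \<Rightarrow> state \<Rightarrow> bool" where
  "scanned xs T L a d s l s' \<longleftrightarrow>
     keeps (insert reg_cur {reg_r..reg_l}) s s' \<and> frame {2, 3} s s' \<and> set l \<subseteq> {..<length xs} \<and>
     (\<forall>i<length l. xs ! (l ! i) = a + int i * d) \<and> fst s' reg_cur = a + int (length l) * d \<and>
     (\<forall>M<2 ^ T. arr s' 2 M = table T (extend L l) M)"

lemma scanned_update:
  "scanned xs T L a d s l s' \<Longrightarrow> r \<in> {reg_r, reg_v} \<Longrightarrow> scanned xs T L a d s l ((fst s')(r := z), snd s')"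
  by (auto simp: scanned_def keeps_def frame_update arr_update)

lemma runs_scan_step:
  assumes s: "ready xs T s" "fst s reg_d = d" and B: "T + 1 \<le> B" "2 * length xs + 1 \<le> B"
    and l: "scanned xs T L a d s l s'" and v: "fst s' reg_v = int v" "v < length xs"
  shows "runs scan_step s' (\<lambda>t s''. t \<le> 560 * (2 ^ T * B\<^sup>2) \<and> fst s'' reg_v = fst s' reg_v \<and>
    fst s'' reg_r = fst s' reg_r \<and>
    (if xs ! v = a + int (length l) * d then scanned xs T L a d s (l @ [v]) s'' else s'' = s'))"
proof -
  from l have k: "keeps (insert reg_cur {reg_r..reg_l}) s s'" and f: "frame {2, 3} s s'"
    and cur: "fst s' reg_cur = a + int (length l) * d"
    and tab: "\<And>M. M < 2 ^ T \<Longrightarrow> arr s' 2 M = table T (extend L l) M"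
    by (auto simp: scanned_def)
  have rd: "ready xs T s'" by (rule ready_transfer[OF s(1) k _ f]) auto
  then have mem: "snd s' (int v) = xs ! v" using v(2) by (simp add: ready_def)
  obtain Y where Y: "Y = 2 ^ T * B\<^sup>2" by simp
  then have Y1: "1 \<le> Y" using B by simp
  show ?thesis
  proof (cases "xs ! v = a + int (length l) * d")
    case True
    have "runs pick s' (\<lambda>t u. t \<le> 540 * (2 ^ T * B\<^sup>2) \<and>
      keeps (insert reg_cur {reg_c..reg_l}) s' u \<and> frame {2, 3} s' u \<and>
      fst u reg_cur = fst s' reg_cur + fst s' reg_d \<and>
      (\<forall>M<2 ^ T. arr u 2 M = table T (extend L l @ map ((#) v) (extend L l)) M))"
      using rd v B tab by (intro runs_pick) (auto simp: ready_def)
    then show ?thesis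
      unfolding scan_step_def runs_Cond
    proof (simp add: v(1) mem cur True, rule_tac runs_mono, assumption, goal_cases)
      case (1 t u)
      have "keeps (insert reg_cur {reg_r..reg_l}) s u" using k 1 by (auto simp: keeps_def)
      moreover have "frame {2, 3} s u" using f 1 frame_trans by blast
      moreover have "fst s' reg_d = d" using k s(2) by (simp add: keeps_def)
      moreover have "xs ! ((l @ [v]) ! i) = a + int i * d" if "i < Suc (length l)" for i
        using that True l by (cases "i = length l") (auto simp: scanned_def nth_append)
      ultimately have "scanned xs T L a d s (l @ [v]) u"
        using 1 l v(2) cur by (auto simp: scanned_def extend_snoc algebra_simps)
      moreover have "fst u reg_v = int v" "fst u reg_r = fst s' reg_r"
        using 1 v(1) by (auto simp: keeps_def)
      ultimately show ?case using 1 Y1 unfolding Y[symmetric] by simp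
    qed
  next
    case False
    then show ?thesis
      using Y1 unfolding scan_step_def runs_Cond Y[symmetric]
      by (simp add: v(1) mem cur runs_Skip) linarith
  qed
qed

lemma runs_scan:
  assumes s: "ready xs T s" "fst s reg_cur = xs ! i" "fst s reg_d = xs ! j - xs ! i"
    and ij: "i < length xs" "j < length xs"
    and B: "T + 1 \<le> B" "2 * length xs + 1 \<le> B"
    and L: "\<And>M. M < 2 ^ T \<Longrightarrow> arr s 2 M = table T L M"
  shows "runs scan s (\<lambda>t s'. t \<le> 580 * (2 ^ T * B ^ 4) \<and>
    keeps (insert reg_cur {reg_r..reg_l}) s s' \<and> frame {2, 3} s s' \<and>
    (\<exists>l. ray xs i j l \<and> (\<forall>M<2 ^ T. arr s' 2 M = table T (extend L l) M)))"
proof -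
  define n where "n = length xs"
  define a where "a = xs ! i"
  define d where "d = xs ! j - a"
  define cur where "cur l = a + int (length l) * d" for l :: "nat list"
  define sc where "sc = scanned xs T L a d s"
  have bound: "int k < aval (Reg reg_n) s' \<longleftrightarrow> k < n" if "sc l s'" for k l s'
    using that s(1) by (auto simp: sc_def scanned_def ready_def keeps_def n_def)
  have B1: "n + 1 \<le> B" using B by (simp add: n_def)
  define Y where "Y = 2 ^ T * B\<^sup>2"
  have Y1: "1 \<le> Y" "1 \<le> B * Y" using B1 by (auto simp: Y_def)
  have time1: "(n + 1) * (560 * Y + 7 + acost (Reg reg_n)) \<le> 570 * (B * Y)"
    using for_time[OF B1 Y1(1), of 560 8] by (simp add: algebra_simps)
  have time2: "(n + 1) * (570 * (B * Y) + 7 + acost (Reg reg_n)) \<le> 580 * (2 ^ T * B ^ 4)"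
  proof -
    have "(n + 1) * (570 * (B * Y) + 7 + acost (Reg reg_n)) \<le> 578 * (B * (B * Y))"
      using for_time[OF B1 Y1(2), of 570 8] by (simp add: algebra_simps)
    also have "B * (B * Y) = 2 ^ T * B ^ 4" by (simp add: Y_def power_numeral_reduce)
    finally show ?thesis by simp
  qed
  \<comment> \<open>After \<open>r\<close> sweeps at least \<open>r\<close> elements are found
    unless the progression has left the input; one sweep may find several.\<close>
  define outer where "outer r s' \<longleftrightarrow> fst s' reg_r = int r \<and>
    (\<exists>l. sc l s' \<and> (r \<le> length l \<or> cur l \<notin> set xs))" for r s'
  \<comment> \<open>Until the quota \<open>Suc r\<close> is met, the next value is at no inspected
    position, so a completed sweep shows that it is not in the input.\<close>
  define inner where "inner r v s' \<longleftrightarrow> fst s' reg_v = int v \<and> fst s' reg_r = int r \<and>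
    (\<exists>l. sc l s' \<and> (Suc r \<le> length l \<or>
      (\<forall>v'<v. xs ! v' \<noteq> cur l) \<and> (r \<le> length l \<or> cur l \<notin> set xs)))" for r v s'
  have step: "runs scan_step s' (\<lambda>t s''. t \<le> 560 * Y \<and>
      inner r (Suc v) ((fst s'')(reg_v := fst s'' reg_v + 1), snd s''))"
    if "inner r v s'" "v < n" for r v s'
  proof -
    obtain l where l: "sc l s'" and prog: "Suc r \<le> length l \<or>
      (\<forall>v'<v. xs ! v' \<noteq> cur l) \<and> (r \<le> length l \<or> cur l \<notin> set xs)"
      and regs: "fst s' reg_v = int v" "fst s' reg_r = int r"
      using \<open>inner r v s'\<close> by (auto simp: inner_def)
    have mem: "xs ! v \<in> set xs" using that(2) by (simp add: n_def)
    show ?thesis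
    proof (rule runs_mono[OF runs_scan_step[OF s(1) _ B l[unfolded sc_def] regs(1)]])
      show "fst s reg_d = d" using s(3) by (simp add: d_def a_def)
      show "v < length xs" using that(2) by (simp add: n_def)
      fix t s''
      assume *: "t \<le> 560 * (2 ^ T * B\<^sup>2) \<and> fst s'' reg_v = fst s' reg_v \<and>
        fst s'' reg_r = fst s' reg_r \<and>
        (if xs ! v = a + int (length l) * d then scanned xs T L a d s (l @ [v]) s'' else s'' = s')"
      let ?u = "((fst s'')(reg_v := fst s'' reg_v + 1), snd s'')"
      have "inner r (Suc v) ?u"
      proof (cases "xs ! v = cur l")
        case True
        then have "sc (l @ [v]) s''" using * by (auto simp: cur_def sc_def)
        then have "sc (l @ [v]) ?u" unfolding sc_def by (rule scanned_update) simp
        \<comment> \<open>A match puts \<open>cur l\<close> into the input, so the invariant yields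
          \<open>r \<le> length l\<close>.\<close>
        moreover have "Suc r \<le> length (l @ [v])" using prog mem True by auto
        ultimately show ?thesis using * regs unfolding inner_def by auto
      next
        case False
        then have "s'' = s'" using * by (simp add: cur_def)
        then have "sc l ?u" using l unfolding sc_def by (auto intro: scanned_update)
        moreover have "Suc r \<le> length l \<or>
          (\<forall>v'<Suc v. xs ! v' \<noteq> cur l) \<and> (r \<le> length l \<or> cur l \<notin> set xs)"
          using prog False by (auto simp: less_Suc_eq)
        ultimately show ?thesis using * regs unfolding inner_def by auto
      qed
      then show "t \<le> 560 * Y \<and> inner r (Suc v) ?u" using * by (simp add: Y_def)
    qed
  qed
  have row: "runs (For reg_v (Reg reg_n) scan_step) s' (\<lambda>t s''. t \<le> 570 * (B * Y) \<and>
      outer (Suc r) ((fst s'')(reg_r := fst s'' reg_r + 1), snd s''))"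
    if "outer r s'" for r s'
  proof (rule runs_For[where N = n and I = "inner r" and Tb = "560 * Y"])
    show "inner r 0 ((fst s')(reg_v := 0), snd s')"
      using that scanned_update[of xs T L a d s _ s' reg_v 0]
      unfolding inner_def outer_def sc_def by auto
    fix t s''
    assume inn: "inner r n s''" and t: "t \<le> (n + 1) * (560 * Y + 7 + acost (Reg reg_n))"
    obtain l where l: "sc l s''" and prog: "Suc r \<le> length l \<or>
      (\<forall>v'<n. xs ! v' \<noteq> cur l) \<and> (r \<le> length l \<or> cur l \<notin> set xs)"
      and regs: "fst s'' reg_r = int r"
      using inn by (auto simp: inner_def)
    have "Suc r \<le> length l \<or> cur l \<notin> set xs"
      using prog by (auto simp: in_set_conv_nth n_def)
    moreover have "sc l ((fst s'')(reg_r := fst s'' reg_r + 1), snd s'')"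
      using l unfolding sc_def by (rule scanned_update) simp
    ultimately show "t \<le> 570 * (B * Y) \<and> outer (Suc r) ((fst s'')(reg_r := fst s'' reg_r + 1), snd s'')"
      using t time1 regs unfolding outer_def by auto
  next
    show "int k < aval (Reg reg_n) s'' \<longleftrightarrow> k < n" if "inner r k s''" for k s''
      using that bound unfolding inner_def by blast
  qed (use step in \<open>auto simp: inner_def\<close>)
  show ?thesis
    unfolding scan_def
  proof (rule runs_For[where N = n and I = outer and Tb = "570 * (B * Y)"])
    have "sc [] ((fst s)(reg_r := 0), snd s)"
      using s L by (auto simp: sc_def scanned_def keeps_def frame_def a_def arr_update extend_Nil)
    then show "outer 0 ((fst s)(reg_r := 0), snd s)" by (auto simp: outer_def)
    fix t s'
    assume "outer n s'" and t: "t \<le> (n + 1) * (570 * (B * Y) + 7 + acost (Reg reg_n))"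
    then obtain l where l: "sc l s'" "n \<le> length l \<or> cur l \<notin> set xs" by (auto simp: outer_def)
    have "l \<noteq> []"
    proof
      assume "l = []"
      then have "cur l = xs ! i" "\<not> n \<le> length l" using ij by (auto simp: cur_def a_def n_def)
      then show False using l(2) ij by auto
    qed
    then have "ray xs i j l"
      using l by (auto simp: ray_def sc_def scanned_def cur_def a_def d_def n_def)
    then show "t \<le> 580 * (2 ^ T * B ^ 4) \<and> keeps (insert reg_cur {reg_r..reg_l}) s s' \<and>
      frame {2, 3} s s' \<and> (\<exists>l. ray xs i j l \<and> (\<forall>M<2 ^ T. arr s' 2 M = table T (extend L l) M))"
      using l(1) t time2 unfolding sc_def scanned_def by auto
  next
    show "int k < aval (Reg reg_n) s' \<longleftrightarrow> k < n" if "outer k s'" for k s'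
      using that bound unfolding outer_def by blast
  qed (use row in \<open>auto simp: outer_def\<close>)
qed

text \<open>
  Array 0 holds the table of the previous round, array 1 the sum for the current round, array 2 the
  table for the current progression, and array 3 is scratch space.
\<close>

definition pair_step :: com where
  "pair_step =
     Seq (fill 2 Skip (array_at 0))
    (Seq (Assign reg_cur (Mem (Reg reg_i)))
    (Seq (Assign reg_d (Sub (Mem (Reg reg_j)) (Mem (Reg reg_i))))
    (Seq scan (fill 1 Skip (Add (array_at 1) (array_at 2))))))"

lemma runs_pair_step:
  assumes s: "ready xs T s" "fst s reg_i = int i" "fst s reg_j = int j"
    and ij: "i < length xs" "j < length xs"
    and B: "T + 1 \<le> B" "2 * length xs + 1 \<le> B"
    and L: "\<And>M. M < 2 ^ T \<Longrightarrow> arr s 0 M = table T L M"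
    and L': "\<And>M. M < 2 ^ T \<Longrightarrow> arr s 1 M = table T L' M"
  shows "runs pair_step s (\<lambda>t s'. t \<le> 760 * (2 ^ T * B ^ 4) \<and> keeps {reg_cur..reg_l} s s' \<and>
    frame {1, 2, 3} s s' \<and>
    (\<exists>l. ray xs i j l \<and> (\<forall>M<2 ^ T. arr s' 1 M = table T (L' @ extend L l) M)))"
  unfolding pair_step_def runs_Seq
proof (rule runs_mono[OF runs_fill_simple[where S = "2 ^ T" and G = "arr s 0"]])
  show "aval (array_at 0) s' = arr s 0 M" if "frame {2} s s'" "fst s' reg_M = int M" for s' M
    using that(2) frame_arr[OF that(1), of 0] by (simp add: aval_array_at)
  fix t1 :: nat and s1
  assume "t1 \<le> 80 * 2 ^ T \<and> keeps {reg_M} s s1 \<and> frame {2} s s1 \<and> (\<forall>M<2 ^ T. arr s1 2 M = arr s 0 M)"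
  then have t1: "t1 \<le> 80 * 2 ^ T" and k1: "keeps {reg_M} s s1" and f1: "frame {2} s s1"
    and g1: "\<And>M. M < 2 ^ T \<Longrightarrow> arr s1 2 M = table T L M" using L by auto
  define s2 where "s2 = ((fst s1)(reg_cur := xs ! i, reg_d := xs ! j - xs ! i), snd s1)"
  have r1: "ready xs T s1" using s(1) k1 _ f1 by (rule ready_transfer) auto
  have regs: "fst s1 reg_i = int i" "fst s1 reg_j = int j" using k1 s by (auto simp: keeps_def)
  have upd: "((fst ((fst s1)(reg_cur := aval (Mem (Reg reg_i)) s1), snd s1))
      (reg_d := aval (Sub (Mem (Reg reg_j)) (Mem (Reg reg_i)))
        ((fst s1)(reg_cur := aval (Mem (Reg reg_i)) s1), snd s1)),
      snd ((fst s1)(reg_cur := aval (Mem (Reg reg_i)) s1), snd s1)) = s2"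
    using r1 regs ij by (simp add: s2_def ready_def)
  have k2: "keeps {reg_cur..reg_l} s s2" and f2: "frame {2} s s2"
    using k1 f1 by (auto simp: s2_def keeps_def frame_def)
  have r2: "ready xs T s2" using s(1) k2 _ f2 by (rule ready_transfer) auto
  have a2: "arr s2 = arr s1" by (simp add: s2_def arr_update)
  let ?Y = "2 ^ T * B ^ 4"
  have "1 \<le> B ^ 4" using B by simp
  then have T4: "2 ^ T \<le> ?Y" by simp
  show "runs (Assign reg_cur (Mem (Reg reg_i))) s1
     (\<lambda>t s'. runs (Assign reg_d (Sub (Mem (Reg reg_j)) (Mem (Reg reg_i)))) s'
       (\<lambda>u s'. runs scan s'
         (\<lambda>v s'. runs (fill 1 Skip (Add (array_at 1) (array_at 2))) s'
           (\<lambda>w s'. t1 + (t + (u + (v + w))) \<le> 760 * ?Y \<and> keeps {reg_cur..reg_l} s s' \<and>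
              frame {1, 2, 3} s s' \<and>
              (\<exists>l. ray xs i j l \<and> (\<forall>M<2 ^ T. arr s' 1 M = table T (L' @ extend L l) M))))))"
    unfolding runs_Assign upd
  proof (rule runs_mono[OF runs_scan[OF r2 _ _ ij B]])
    show "fst s2 reg_cur = xs ! i" "fst s2 reg_d = xs ! j - xs ! i" by (simp_all add: s2_def)
    show "arr s2 2 M = table T L M" if "M < 2 ^ T" for M using g1[OF that] by (simp add: a2)
    fix t3 :: nat and s3
    assume "t3 \<le> 580 * (2 ^ T * B ^ 4) \<and> keeps (insert reg_cur {reg_r..reg_l}) s2 s3 \<and>
      frame {2, 3} s2 s3 \<and>
      (\<exists>l. ray xs i j l \<and> (\<forall>M<2 ^ T. arr s3 2 M = table T (extend L l) M))"
    then obtain l where t3: "t3 \<le> 580 * ?Y" and k: "keeps (insert reg_cur {reg_r..reg_l}) s2 s3"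
      and f: "frame {2, 3} s2 s3" and l: "ray xs i j l"
      and g3: "\<And>M. M < 2 ^ T \<Longrightarrow> arr s3 2 M = table T (extend L l) M" by auto
    have k3: "keeps {reg_cur..reg_l} s s3" using k2 k by (auto simp: keeps_def)
    have f3: "frame {2, 3} s s3"
      using frame_trans[OF frame_mono[OF f2, of "{2, 3}"] f] by simp
    have a3: "arr s3 1 = arr s 1" using f3 by (rule frame_arr) auto
    show "runs (fill 1 Skip (Add (array_at 1) (array_at 2))) s3
       (\<lambda>w s'. t1 + (1 + acost (Mem (Reg reg_i)) +
           (1 + acost (Sub (Mem (Reg reg_j)) (Mem (Reg reg_i))) + (t3 + w))) \<le> 760 * ?Y \<and>
         keeps {reg_cur..reg_l} s s' \<and> frame {1, 2, 3} s s' \<and>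
         (\<exists>l. ray xs i j l \<and> (\<forall>M<2 ^ T. arr s' 1 M = table T (L' @ extend L l) M)))"
    proof (rule runs_mono[OF runs_fill_simple[where S = "2 ^ T" and
          G = "\<lambda>M. arr s3 1 M + arr s3 2 M"]])
      show "fst s3 reg_S = int (2 ^ T)" using k3 s(1) by (simp add: keeps_def ready_def)
      show "aval (Add (array_at 1) (array_at 2)) s' = arr s3 1 M + arr s3 2 M"
        if "frame {1} s3 s'" "fst s' reg_M = int M" "arr s' 1 M = arr s3 1 M" for s' M
        using that(2,3) frame_arr[OF that(1), of 2] by (simp add: aval_array_at)
      fix t4 :: nat and s4
      assume "t4 \<le> 80 * 2 ^ T \<and> keeps {reg_M} s3 s4 \<and> frame {1} s3 s4 \<and>
        (\<forall>M<2 ^ T. arr s4 1 M = arr s3 1 M + arr s3 2 M)"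
      then have t4: "t4 \<le> 80 * 2 ^ T" and k4: "keeps {reg_M} s3 s4" and f4: "frame {1} s3 s4"
        and g4: "\<And>M. M < 2 ^ T \<Longrightarrow> arr s4 1 M = table T (L' @ extend L l) M"
        using L' g3 a3 by (auto simp: table_append)
      have "keeps {reg_cur..reg_l} s s4" using k3 k4 by (auto simp: keeps_def)
      moreover have "frame {1, 2, 3} s s4"
        by (rule frame_trans[OF frame_mono[OF f3] frame_mono[OF f4]]) auto
      moreover have "1 \<le> ?Y" using T4 by (meson one_le_numeral one_le_power order_trans)
      then have "t1 + (1 + acost (Mem (Reg reg_i)) +
           (1 + acost (Sub (Mem (Reg reg_j)) (Mem (Reg reg_i))) + (t3 + t4))) \<le> 760 * ?Y"
        using t1 t3 t4 T4 unfolding acost.simps by linarith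
      ultimately show "t1 + (1 + acost (Mem (Reg reg_i)) +
           (1 + acost (Sub (Mem (Reg reg_j)) (Mem (Reg reg_i))) + (t3 + t4))) \<le> 760 * ?Y \<and>
         keeps {reg_cur..reg_l} s s4 \<and> frame {1, 2, 3} s s4 \<and>
         (\<exists>l. ray xs i j l \<and> (\<forall>M<2 ^ T. arr s4 1 M = table T (L' @ extend L l) M))"
        using l g4 by blast
    qed (simp_all add: acost_array_at)
  qed
qed (use s in \<open>simp_all add: ready_def acost_array_at\<close>)

section \<open>One round: adding one progression in all possible ways\<close>

definition cover_round :: com where
  "cover_round =
     Seq (fill 1 Skip (Num 0))
    (Seq (For reg_i (Reg reg_n) (For reg_j (Reg reg_n) pair_step))
      (fill 0 Skip (array_at 1)))"

lemma runs_pairs: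
  assumes s: "ready xs T s" and B: "T + 1 \<le> B" "2 * length xs + 1 \<le> B"
    and L: "\<And>M. M < 2 ^ T \<Longrightarrow> arr s 0 M = table T L M"
    and zero: "\<And>M. M < 2 ^ T \<Longrightarrow> arr s 1 M = 0"
  shows "runs (For reg_i (Reg reg_n) (For reg_j (Reg reg_n) pair_step)) s
    (\<lambda>t s'. t \<le> 780 * (2 ^ T * B ^ 6) \<and> keeps {reg_i..reg_l} s s' \<and> frame {1, 2, 3} s s' \<and>
      (\<exists>L'. collects xs L ({..<length xs} \<times> {..<length xs}) L' \<and>
        (\<forall>M<2 ^ T. arr s' 1 M = table T L' M)))"
proof -
  define n where "n = length xs"
  define Y where "Y = 2 ^ T * B ^ 4"
  have B1: "n + 1 \<le> B" using B by (simp add: n_def)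
  have Y1: "1 \<le> Y" "1 \<le> B * Y" using B1 by (auto simp: Y_def)
  have time1: "(n + 1) * (760 * Y + 7 + acost (Reg reg_n)) \<le> 770 * (B * Y)"
    using for_time[OF B1 Y1(1), of 760 8] by (simp add: algebra_simps)
  have time2: "(n + 1) * (770 * (B * Y) + 7 + acost (Reg reg_n)) \<le> 780 * (2 ^ T * B ^ 6)"
  proof -
    have "(n + 1) * (770 * (B * Y) + 7 + acost (Reg reg_n)) \<le> 778 * (B * (B * Y))"
      using for_time[OF B1 Y1(2), of 770 8] by (simp add: algebra_simps)
    also have "B * (B * Y) = 2 ^ T * B ^ 6" by (simp add: Y_def power_numeral_reduce)
    finally show ?thesis by simp
  qed
  define inv where "inv P s' \<longleftrightarrow> keeps {reg_i..reg_l} s s' \<and> frame {1, 2, 3} s s' \<and>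
    (\<exists>L'. collects xs L P L' \<and> (\<forall>M<2 ^ T. arr s' 1 M = table T L' M))" for P s'
  have inv_update: "inv P ((fst s')(r := z), snd s')" if "inv P s'" "r \<in> {reg_i, reg_j}" for P s' r z
    using that by (auto simp: inv_def keeps_def frame_update arr_update)
  have bound: "int k < aval (Reg reg_n) s' \<longleftrightarrow> k < n" if "inv P s'" for k P s'
    using that s by (auto simp: inv_def ready_def keeps_def n_def)
  define rows where "rows i = {..<i} \<times> {..<n}" for i :: nat
  define outer where "outer i s' \<longleftrightarrow> fst s' reg_i = int i \<and> inv (rows i) s'" for i s'
  define inner where "inner i j s' \<longleftrightarrow> fst s' reg_j = int j \<and> fst s' reg_i = int i \<and>
    inv (rows i \<union> {i} \<times> {..<j}) s'" for i j s'
  have step: "runs pair_step s' (\<lambda>t s''. t \<le> 760 * Y \<and>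
      inner i (Suc j) ((fst s'')(reg_j := fst s'' reg_j + 1), snd s''))"
    if I: "inner i j s'" "i < n" "j < n" for i j s'
  proof -
    obtain L' where k: "keeps {reg_i..reg_l} s s'" and f: "frame {1, 2, 3} s s'"
      and c: "collects xs L (rows i \<union> {i} \<times> {..<j}) L'"
      and L': "\<And>M. M < 2 ^ T \<Longrightarrow> arr s' 1 M = table T L' M"
      and regs: "fst s' reg_i = int i" "fst s' reg_j = int j"
      using I(1) by (auto simp: inner_def inv_def)
    have r: "ready xs T s'" using s k _ f by (rule ready_transfer) auto
    have L0: "arr s' 0 M = table T L M" if "M < 2 ^ T" for M
      using L[OF that] frame_arr[OF f, of 0] by simp
    show ?thesis
    proof (rule runs_mono[OF runs_pair_step[OF r regs _ _ B L0 L']])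
      fix t s''
      assume *: "t \<le> 760 * (2 ^ T * B ^ 4) \<and> keeps {reg_cur..reg_l} s' s'' \<and>
        frame {1, 2, 3} s' s'' \<and>
        (\<exists>l. ray xs i j l \<and> (\<forall>M<2 ^ T. arr s'' 1 M = table T (L' @ extend L l) M))"
      then obtain l where l: "ray xs i j l" "\<forall>M<2 ^ T. arr s'' 1 M = table T (L' @ extend L l) M"
        by blast
      have "insert (i, j) (rows i \<union> {i} \<times> {..<j}) = rows i \<union> {i} \<times> {..<Suc j}" by auto
      then have "collects xs L (rows i \<union> {i} \<times> {..<Suc j}) (L' @ extend L l)"
        using collects_append[OF c l(1)] by simp
      moreover have "keeps {reg_i..reg_l} s s''" using k * by (auto simp: keeps_def)
      moreover have "frame {1, 2, 3} s s''" using f * frame_trans by blast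
      ultimately have "inv (rows i \<union> {i} \<times> {..<Suc j}) s''" using l(2) unfolding inv_def by blast
      moreover have "fst s'' reg_j = int j" "fst s'' reg_i = int i"
        using * regs by (auto simp: keeps_def)
      ultimately show "t \<le> 760 * Y \<and> inner i (Suc j) ((fst s'')(reg_j := fst s'' reg_j + 1), snd s'')"
        using * inv_update by (simp add: inner_def Y_def)
    qed (use I in \<open>auto simp: n_def\<close>)
  qed
  have row: "runs (For reg_j (Reg reg_n) pair_step) s' (\<lambda>t s''. t \<le> 770 * (B * Y) \<and>
      outer (Suc i) ((fst s'')(reg_i := fst s'' reg_i + 1), snd s''))"
    if "outer i s'" "i < n" for i s'
  proof (rule runs_For[where N = n and I = "inner i" and Tb = "760 * Y"])
    show "inner i 0 ((fst s')(reg_j := 0), snd s')"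
      using that inv_update unfolding inner_def outer_def by auto
    fix t s''
    assume *: "inner i n s''" and t: "t \<le> (n + 1) * (760 * Y + 7 + acost (Reg reg_n))"
    have "rows i \<union> {i} \<times> {..<n} = rows (Suc i)" by (auto simp: rows_def)
    then have "outer (Suc i) ((fst s'')(reg_i := fst s'' reg_i + 1), snd s'')"
      using * inv_update unfolding inner_def outer_def by auto
    then show "t \<le> 770 * (B * Y) \<and> outer (Suc i) ((fst s'')(reg_i := fst s'' reg_i + 1), snd s'')"
      using t time1 by simp
  next
    show "int k < aval (Reg reg_n) s'' \<longleftrightarrow> k < n" if "inner i k s''" for k s''
      using that bound unfolding inner_def by blast
  qed (use step that in \<open>auto simp: inner_def\<close>)
  show ?thesis
  proof (rule runs_For[where N = n and I = outer and Tb = "770 * (B * Y)"])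
    \<comment> \<open>A zero array is the table of the empty list of words.\<close>
    have "rows 0 = {}" by (simp add: rows_def)
    then show "outer 0 ((fst s)(reg_i := 0), snd s)"
      using zero collects_empty[of xs L]
      by (auto simp: outer_def inv_def keeps_def frame_def arr_update table_def intro!: exI[of _ "[]"])
    fix t s'
    assume "outer n s'" and t: "t \<le> (n + 1) * (770 * (B * Y) + 7 + acost (Reg reg_n))"
    then show "t \<le> 780 * (2 ^ T * B ^ 6) \<and> keeps {reg_i..reg_l} s s' \<and> frame {1, 2, 3} s s' \<and>
      (\<exists>L'. collects xs L ({..<length xs} \<times> {..<length xs}) L' \<and>
        (\<forall>M<2 ^ T. arr s' 1 M = table T L' M))"
      using time2 unfolding outer_def inv_def rows_def n_def by auto
  next
    show "int k < aval (Reg reg_n) s' \<longleftrightarrow> k < n" if "outer k s'" for k s'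
      using that bound unfolding outer_def by blast
  qed (use row in \<open>auto simp: outer_def\<close>)
qed

lemma runs_cover_round:
  assumes s: "ready xs T s" and B: "T + 1 \<le> B" "2 * length xs + 1 \<le> B"
    and L: "\<And>M. M < 2 ^ T \<Longrightarrow> arr s 0 M = table T L M"
    and m: "distinct xs" "reaches xs m L"
  shows "runs cover_round s (\<lambda>t s'. t \<le> 950 * (2 ^ T * B ^ 6) \<and> keeps {reg_i..reg_l} s s' \<and>
    frame {0, 1, 2, 3} s s' \<and>
    (\<exists>L'. reaches xs (Suc m) L' \<and> (\<forall>M<2 ^ T. arr s' 0 M = table T L' M)))"
  unfolding cover_round_def runs_Seq
proof (rule runs_mono[OF runs_fill_simple[where S = "2 ^ T" and G = "\<lambda>_. 0"]])
  fix t1 :: nat and s1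
  assume "t1 \<le> 80 * 2 ^ T \<and> keeps {reg_M} s s1 \<and> frame {1} s s1 \<and> (\<forall>M<2 ^ T. arr s1 1 M = 0)"
  then have t1: "t1 \<le> 80 * 2 ^ T" and k1: "keeps {reg_M} s s1" and f1: "frame {1} s s1"
    and z1: "\<And>M. M < 2 ^ T \<Longrightarrow> arr s1 1 M = 0" by auto
  have r1: "ready xs T s1" using s k1 _ f1 by (rule ready_transfer) auto
  have L1: "arr s1 0 M = table T L M" if "M < 2 ^ T" for M
    using L[OF that] frame_arr[OF f1, of 0] by simp
  let ?Y = "2 ^ T * B ^ 6"
  have "1 \<le> B ^ 6" using B by simp
  then have T6: "2 ^ T \<le> ?Y" by simp
  show "runs (For reg_i (Reg reg_n) (For reg_j (Reg reg_n) pair_step)) s1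
     (\<lambda>t s'. runs (fill 0 Skip (array_at 1)) s'
       (\<lambda>u s'. t1 + (t + u) \<le> 950 * ?Y \<and> keeps {reg_i..reg_l} s s' \<and> frame {0, 1, 2, 3} s s' \<and>
         (\<exists>L'. reaches xs (Suc m) L' \<and> (\<forall>M<2 ^ T. arr s' 0 M = table T L' M))))"
  proof (rule runs_mono[OF runs_pairs[OF r1 B L1 z1]])
    fix t2 s2
    assume "t2 \<le> 780 * ?Y \<and> keeps {reg_i..reg_l} s1 s2 \<and> frame {1, 2, 3} s1 s2 \<and>
      (\<exists>L'. collects xs L ({..<length xs} \<times> {..<length xs}) L' \<and>
        (\<forall>M<2 ^ T. arr s2 1 M = table T L' M))"
    then obtain L' where t2: "t2 \<le> 780 * ?Y" and k: "keeps {reg_i..reg_l} s1 s2"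
      and f: "frame {1, 2, 3} s1 s2" and c: "collects xs L ({..<length xs} \<times> {..<length xs}) L'"
      and g2: "\<And>M. M < 2 ^ T \<Longrightarrow> arr s2 1 M = table T L' M" by auto
    have k2: "keeps {reg_i..reg_l} s s2" using k1 k by (auto simp: keeps_def)
    have f2: "frame {1, 2, 3} s s2"
      using frame_trans[OF frame_mono[OF f1, of "{1, 2, 3}"] f] by simp
    show "runs (fill 0 Skip (array_at 1)) s2
       (\<lambda>u s'. t1 + (t2 + u) \<le> 950 * ?Y \<and> keeps {reg_i..reg_l} s s' \<and> frame {0, 1, 2, 3} s s' \<and>
         (\<exists>L'. reaches xs (Suc m) L' \<and> (\<forall>M<2 ^ T. arr s' 0 M = table T L' M)))"
    proof (rule runs_mono[OF runs_fill_simple[where S = "2 ^ T" and G = "arr s2 1"]])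
      show "fst s2 reg_S = int (2 ^ T)" using k2 s by (simp add: keeps_def ready_def)
      show "aval (array_at 1) s' = arr s2 1 M"
        if "frame {0} s2 s'" "fst s' reg_M = int M" for s' M
        using that(2) frame_arr[OF that(1), of 1] by (simp add: aval_array_at)
      fix t3 :: nat and s3
      assume *: "t3 \<le> 80 * 2 ^ T \<and> keeps {reg_M} s2 s3 \<and> frame {0} s2 s3 \<and>
        (\<forall>M<2 ^ T. arr s3 0 M = arr s2 1 M)"
      have "keeps {reg_i..reg_l} s s3" using k2 * by (auto simp: keeps_def)
      moreover have "frame {0, 1, 2, 3} s s3"
        by (rule frame_trans[OF frame_mono[OF f2] frame_mono[of "{0}"]]) (use * in auto)
      moreover have "t1 + (t2 + t3) \<le> 950 * ?Y" using t1 t2 * T6 by linarith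
      moreover have "\<forall>M<2 ^ T. arr s3 0 M = table T L' M" using * g2 by simp
      ultimately show "t1 + (t2 + t3) \<le> 950 * ?Y \<and> keeps {reg_i..reg_l} s s3 \<and>
        frame {0, 1, 2, 3} s s3 \<and>
        (\<exists>L'. reaches xs (Suc m) L' \<and> (\<forall>M<2 ^ T. arr s3 0 M = table T L' M))"
        using collects_reaches[OF m c] by blast
    qed (simp_all add: acost_array_at)
  qed
qed (use s in \<open>simp_all add: ready_def\<close>)

definition cover_rounds :: com where
  "cover_rounds = For reg_o (Reg reg_m) cover_round"

text \<open>The exponent 7 counts loop levels: two for a coefficient, two for the sweeps along a
  ray, two for the pairs of positions, one for the rounds. The factor \<open>2 ^ T\<close> is the
  table length.\<close>

lemma runs_cover_rounds:
  assumes s: "ready xs T s" "fst s reg_m = int m"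
    and B: "T + 1 \<le> B" "2 * length xs + 1 \<le> B" "m + 1 \<le> B"
    and L: "\<And>M. M < 2 ^ T \<Longrightarrow> arr s 0 M = table T [[]] M"
    and xs: "distinct xs"
  shows "runs cover_rounds s (\<lambda>t s'. t \<le> 960 * (2 ^ T * B ^ 7) \<and> keeps {reg_o..reg_l} s s' \<and>
    (\<exists>L. reaches xs m L \<and> (\<forall>M<2 ^ T. arr s' 0 M = table T L M)))"
proof -
  define Y where "Y = 2 ^ T * B ^ 6"
  have Y1: "1 \<le> Y" using B by (auto simp: Y_def)
  have time: "(m + 1) * (950 * Y + 7 + acost (Reg reg_m)) \<le> 960 * (2 ^ T * B ^ 7)"
  proof -
    have "(m + 1) * (950 * Y + 7 + acost (Reg reg_m)) \<le> 958 * (B * Y)"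
      using for_time[OF B(3) Y1, of 950 8] by (simp add: algebra_simps)
    also have "B * Y = 2 ^ T * B ^ 7" by (simp add: Y_def power_numeral_reduce)
    finally show ?thesis by simp
  qed
  define I where "I o' s' \<longleftrightarrow> fst s' reg_o = int o' \<and> keeps {reg_o..reg_l} s s' \<and>
    frame {0, 1, 2, 3} s s' \<and> (\<exists>L. reaches xs o' L \<and> (\<forall>M<2 ^ T. arr s' 0 M = table T L M))" for o' s'
  show ?thesis
    unfolding cover_rounds_def
  proof (rule runs_For[where N = m and I = I and Tb = "950 * Y"])
    show "I 0 ((fst s)(reg_o := 0), snd s)"
      using L reaches_0[of xs] by (auto simp: I_def keeps_def frame_def arr_update)
    show "int k < aval (Reg reg_m) s' \<longleftrightarrow> k < m" if "I k s'" for k s'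
      using that s(2) by (auto simp: I_def keeps_def)
    show "t \<le> 960 * (2 ^ T * B ^ 7) \<and> keeps {reg_o..reg_l} s s' \<and>
        (\<exists>L. reaches xs m L \<and> (\<forall>M<2 ^ T. arr s' 0 M = table T L M))"
      if "I m s'" "t \<le> (m + 1) * (950 * Y + 7 + acost (Reg reg_m))" for t s'
      using that time unfolding I_def by auto
    fix k s'
    assume "I k s'"
    then obtain L where k: "keeps {reg_o..reg_l} s s'" and f: "frame {0, 1, 2, 3} s s'"
      and r: "reaches xs k L" and L: "\<And>M. M < 2 ^ T \<Longrightarrow> arr s' 0 M = table T L M"
      and c: "fst s' reg_o = int k" by (auto simp: I_def)
    have rd: "ready xs T s'" using s(1) k _ f by (rule ready_transfer) auto
    show "runs cover_round s' (\<lambda>t s''. t \<le> 950 * Y \<and> I (Suc k) ((fst s'')(reg_o := fst s'' reg_o + 1), snd s''))"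
    proof (rule runs_mono[OF runs_cover_round[OF rd B(1,2) L xs r]])
      fix t s''
      assume *: "t \<le> 950 * (2 ^ T * B ^ 6) \<and> keeps {reg_i..reg_l} s' s'' \<and>
        frame {0, 1, 2, 3} s' s'' \<and>
        (\<exists>L'. reaches xs (Suc k) L' \<and> (\<forall>M<2 ^ T. arr s'' 0 M = table T L' M))"
      have "frame {0, 1, 2, 3} s s''" using f * frame_trans by blast
      moreover have "keeps {reg_o..reg_l} s s''" "fst s'' reg_o = int k"
        using k * c by (auto simp: keeps_def)
      ultimately show "t \<le> 950 * Y \<and> I (Suc k) ((fst s'')(reg_o := fst s'' reg_o + 1), snd s'')"
        using * by (auto simp: I_def Y_def keeps_def frame_update arr_update)
    qed
  qed (auto simp: I_def)
qed

section \<open>The algorithm\<close>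

text \<open>Each element is a bivector, so \<open>t\<close> elements need \<open>2 * t\<close> basis
  vectors. One stored 1 turns array 0 into the table of \<open>[[]]\<close>, as all other negative
  addresses hold 0 initially.\<close>

definition decide :: com where
  "decide =
     Seq (Assign reg_T (Add (Reg reg_T) (Reg reg_T)))
    (Seq (Assign reg_S (Num 1))
    (Seq (double reg_l reg_S (Reg reg_T))
    (Seq (Store (cell_at 0 (Num 0)) (Num 1))
    (Seq cover_rounds
      (Cond (Less (Num 0) (Mem (cell_at 0 (Sub (Reg reg_S) (Num 1)))))
        (Assign reg_n (Num 1)) (Assign reg_n (Num 0)))))))"

lemma runs_decide:
  assumes s: "fst s reg_n = int (length xs)" "fst s reg_T = int t" "fst s reg_m = int m"
    and mem: "snd s = snd (input_state xs k)"
    and B: "2 * t + 1 \<le> B" "2 * length xs + 1 \<le> B" "m + 1 \<le> B"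
    and xs: "distinct xs"
  shows "runs decide s (\<lambda>u s'. u \<le> 1100 * (2 ^ (2 * t) * B ^ 7) \<and>
    fst s' 0 = (if \<exists>U. U \<subseteq> set xs \<and> card U = t \<and> AP_reach (set xs) m U then 1 else 0))"
  unfolding decide_def runs_Seq runs_Assign
proof (rule runs_mono[OF runs_double[where N = "2 * t"]], goal_cases)
  case (3 u1 s1)
  define T where "T = 2 * t"
  have u1: "u1 \<le> (T + 1) * 12" using 3 by (simp add: T_def)
  have s1: "s1 = ((fst s)(reg_T := int T, reg_S := 2 ^ T, reg_l := int T), snd s)"
    using 3 s(2) by (auto simp: T_def fun_eq_iff)
  have c0: "aval (cell_at 0 (Num 0)) s1 = cell 0 0" by (rule aval_cell_at) simp
  define s2 where "s2 = (fst s1, (snd s1)(cell 0 0 := 1))"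
  have "ready xs T s2"
    using s(1) cell_neg[of 0 0] by (auto simp: ready_def s2_def s1 mem input_state_def)
  moreover have "fst s2 reg_m = int m" using s(3) by (simp add: s2_def s1)
  moreover have "arr s2 0 M = table T [[]] M" for M
    using cell_neg[of 0 M] cell_eq_iff[of 0 0 M 0]
    by (auto simp: arr_def s2_def s1 mem input_state_def table_def unit_vec_def)
  ultimately have r: "runs cover_rounds s2 (\<lambda>u s'. u \<le> 960 * (2 ^ T * B ^ 7) \<and> keeps {reg_o..reg_l} s2 s' \<and>
      (\<exists>L. reaches xs m L \<and> (\<forall>M<2 ^ T. arr s' 0 M = table T L M)))"
    using B xs by (intro runs_cover_rounds) (auto simp: T_def)
  show ?case
    unfolding runs_Store c0 aval.simps s2_def[symmetric]
  proof (rule runs_mono[OF r])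
    fix u2 s3
    assume *: "u2 \<le> 960 * (2 ^ T * B ^ 7) \<and> keeps {reg_o..reg_l} s2 s3 \<and>
      (\<exists>L. reaches xs m L \<and> (\<forall>M<2 ^ T. arr s3 0 M = table T L M))"
    then obtain L where L: "reaches xs m L" "arr s3 0 (2 ^ T - 1) = table T L (2 ^ T - 1)" by auto
    have S: "fst s3 reg_S = 2 ^ T" using * by (simp add: keeps_def s2_def s1)
    have "aval (Sub (Reg reg_S) (Num 1)) s3 = int (2 ^ T - 1)" by (simp add: S of_nat_diff)
    from aval_cell_at[OF this]
    have val: "aval (Mem (cell_at 0 (Sub (Reg reg_S) (Num 1)))) s3 = table T L (2 ^ T - 1)"
      using L(2) by (simp only: aval.simps arr_def)
    have top: "0 < table T L (2 ^ T - 1) \<longleftrightarrow> (\<exists>U. U \<subseteq> set xs \<and> card U = t \<and> AP_reach (set xs) m U)"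
      unfolding T_def table_top reaches_iff[OF xs L(1)] ..
    obtain Y where Y: "Y = 2 ^ T * B ^ 7" by simp
    have "1 * B ^ 1 \<le> 2 ^ T * B ^ 7" using B(1) by (intro mult_mono power_increasing) auto
    then have "B \<le> Y" by (simp add: Y)
    moreover have "u1 \<le> B * 12" using u1 B(1) by (simp add: T_def)
    ultimately show "runs (Cond (Less (Num 0) (Mem (cell_at 0 (Sub (Reg reg_S) (Num 1)))))
        (Assign reg_n (Num 1)) (Assign reg_n (Num 0))) s3
      (\<lambda>u s'. 1 + acost (Add (Reg reg_T) (Reg reg_T)) + (1 + acost (Num 1) + (u1 +
         (1 + acost (cell_at 0 (Num 0)) + acost (Num 1) + (u2 + u)))) \<le> 1100 * (2 ^ (2 * t) * B ^ 7) \<and>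
        fst s' 0 = (if \<exists>U. U \<subseteq> set xs \<and> card U = t \<and> AP_reach (set xs) m U then 1 else 0))"
      using * B(1) unfolding runs_Cond bval.simps val T_def[symmetric] Y[symmetric] aval.simps(1) top
      by (auto simp: runs_Assign acost_cell_at)
  qed
qed (use s in auto)

text \<open>If \<open>n < 3 * K\<close>, then \<open>m = (n - K) / 2\<close> is
  \<open>n div 2 - k\<close>, so the precomputed half replaces a division.\<close>

definition setup_parameters :: com where
  "setup_parameters =
     Seq (Assign reg_T (Add (Add (Reg reg_K) (Reg reg_K)) (Reg reg_K)))
    (Seq (Assign reg_m (Reg reg_K))
      (Cond (Less (Reg reg_n) (Reg reg_T))
        (Seq (Assign reg_T (Reg reg_n)) (Assign reg_m (Sub (Reg reg_half) (Reg reg_k)))) Skip))"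

lemma runs_setup_parameters:
  "runs setup_parameters s (\<lambda>u s'. u \<le> 30 \<and> snd s' = snd s \<and> fst s' reg_n = fst s reg_n \<and>
     fst s' reg_T = min (fst s reg_n) (3 * fst s reg_K) \<and>
     fst s' reg_m = (if fst s reg_n < 3 * fst s reg_K then fst s reg_half - fst s reg_k
       else fst s reg_K))"
  by (auto simp: setup_parameters_def runs_simps min_def)

text \<open>The first loop counts up to \<open>n div 2\<close> for lack of division;
  \<open>n - 2 * (n div 2)\<close> is then the parity term of \<open>K\<close>.\<close>

definition cover_program :: com where
  "cover_program =
     Seq (For reg_l (Reg reg_n)
       (Cond (Less (Add (Add (Reg reg_half) (Reg reg_half)) (Num 1)) (Reg reg_n))
         (Assign reg_half (Add (Reg reg_half) (Num 1))) Skip))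
    (Seq (Assign reg_K (Add (Add (Reg reg_k) (Reg reg_k))
       (Sub (Sub (Reg reg_n) (Reg reg_half)) (Reg reg_half))))
    (Cond (Less (Num 0) (Reg reg_K))
      (Seq setup_parameters (Cond (Less (Reg reg_m) (Num 1)) (Assign reg_n (Num 0)) decide))
      (Assign reg_n (Num 1))))"

lemma runs_cover_program:
  fixes xs :: "int list"
  assumes xs: "distinct xs"
  defines "n \<equiv> length xs"
  shows "runs cover_program (input_state xs k) (\<lambda>u s'.
    u \<le> 2000 * (2 ^ (12 * nat \<bar>k\<bar> + 6) * (2 * n + 2) ^ 7) \<and>
    fst s' 0 = (if coverable_below (set xs) k then 1 else 0))"
proof -
  define s0 where "s0 = input_state xs k"
  define B where "B = 2 * n + 2"
  \<comment> \<open>The exponent of the table length is \<open>2 * t \<le> 6 * K\<close>, and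
    \<open>K \<le> 2 * \<bar>k\<bar> + 1\<close>.\<close>
  define E where "E = 12 * nat \<bar>k\<bar> + 6"
  have s0: "fst s0 reg_n = int n" "fst s0 reg_k = k" "fst s0 reg_half = 0"
    by (simp_all add: s0_def input_state_def n_def)
  have card: "card (set xs) = n" using xs by (simp add: distinct_card n_def)
  define K where "K = 2 * k + int (n mod 2)"
  define I where "I i s' \<longleftrightarrow> fst s' reg_l = int i \<and> snd s' = snd s0 \<and> fst s' reg_n = int n \<and>
    fst s' reg_k = k \<and> fst s' reg_half = int (min i (n div 2))" for i s'
  obtain Y where Y: "Y = 2 ^ E * B ^ 7" by simp
  have "1 * B ^ 1 \<le> 2 ^ E * B ^ 7" by (intro mult_mono power_increasing) (auto simp: B_def)
  then have BY: "B \<le> Y" by (simp add: Y)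
  show ?thesis
    unfolding cover_program_def s0_def[symmetric] runs_Seq B_def[symmetric] E_def[symmetric] Y[symmetric]
  proof (rule runs_For[where N = n and I = I and Tb = 20])
    show "I 0 ((fst s0)(reg_l := 0), snd s0)" using s0 by (simp add: I_def)
    show "int j < aval (Reg reg_n) s' \<longleftrightarrow> j < n" if "I j s'" for j s' using that by (simp add: I_def)
    show "runs (Cond (Less (Add (Add (Reg reg_half) (Reg reg_half)) (Num 1)) (Reg reg_n))
         (Assign reg_half (Add (Reg reg_half) (Num 1))) Skip) s'
       (\<lambda>t s''. t \<le> 20 \<and> I (Suc j) ((fst s'')(reg_l := fst s'' reg_l + 1), snd s''))"
      if "I j s'" "j < n" for j s'
    \<comment> \<open>The guard asks whether one more pair fits into \<open>n\<close>, so the count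
      stops at \<open>n div 2\<close>.\<close>
    proof (cases "j < n div 2")
      case True
      then have "2 * int j + 1 < int n" by linarith
      then show ?thesis using that True by (simp add: I_def runs_Cond runs_Assign min_def)
    next
      case False
      then have "\<not> 2 * int (n div 2) + 1 < int n" by linarith
      then show ?thesis using that False by (simp add: I_def runs_Cond runs_Skip min_def)
    qed
    fix t1 s1
    assume I: "I n s1" and "t1 \<le> (n + 1) * (20 + 7 + acost (Reg reg_n))"
    then have t1: "t1 \<le> 28 * B" by (simp add: B_def)
    have half: "fst s1 reg_half = int (n div 2)" using I by (simp add: I_def)
    have K_eq: "fst s1 reg_k + fst s1 reg_k + (fst s1 reg_n - fst s1 reg_half - fst s1 reg_half) = K"
      using I half unfolding I_def K_def by (simp add: zmod_int zdiv_int) presburger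
    define s2 where "s2 = ((fst s1)(reg_K := K), snd s1)"
    have s2: "fst s2 reg_n = int n" "fst s2 reg_K = K" "fst s2 reg_half = int (n div 2)"
      "fst s2 reg_k = k" "snd s2 = snd s0"
      using I half by (auto simp: s2_def I_def)
    show "runs (Assign reg_K (Add (Add (Reg reg_k) (Reg reg_k))
         (Sub (Sub (Reg reg_n) (Reg reg_half)) (Reg reg_half)))) s1
       (\<lambda>t s'. runs (Cond (Less (Num 0) (Reg reg_K))
          (Seq setup_parameters (Cond (Less (Reg reg_m) (Num 1)) (Assign reg_n (Num 0)) decide))
          (Assign reg_n (Num 1))) s'
         (\<lambda>u s'. t1 + (t + u) \<le> 2000 * Y \<and>
           fst s' 0 = (if coverable_below (set xs) k then 1 else 0)))"
      unfolding runs_Assign aval.simps K_eq s2_def[symmetric] runs_Cond[of _ _ _ s2]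
    proof (cases "0 < K")
      case False
      then have "coverable_below (set xs) k"
        by (intro coverable_below_nonpos) (simp_all add: card K_def)
      then show "runs (if bval (Less (Num 0) (Reg reg_K)) s2
          then Seq setup_parameters (Cond (Less (Reg reg_m) (Num 1)) (Assign reg_n (Num 0)) decide)
          else Assign reg_n (Num 1)) s2
         (\<lambda>u s'. t1 + (1 + acost (Add (Add (Reg reg_k) (Reg reg_k))
             (Sub (Sub (Reg reg_n) (Reg reg_half)) (Reg reg_half))) +
             (1 + bcost (Less (Num 0) (Reg reg_K)) + u)) \<le> 2000 * Y \<and>
           fst s' 0 = (if coverable_below (set xs) k then 1 else 0))"
        using False t1 BY B_def by (simp add: s2 runs_Assign)
    next
      case True
      define t where "t = min (int n) (3 * K)"
      define m where "m = (if int n < 3 * K then int (n div 2) - k else K)"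
      have tm: "2 * m = t - K"
        unfolding t_def m_def K_def by (simp add: min_def zmod_int zdiv_int) presburger
      have t_bounds: "0 \<le> t" "t \<le> int n" "t \<le> 3 * K" using True by (auto simp: t_def)
      have iff: "coverable_below (set xs) k \<longleftrightarrow>
          1 \<le> m \<and> (\<exists>U. U \<subseteq> set xs \<and> card U = nat t \<and> AP_reach (set xs) (nat m) U)"
        by (rule coverable_below_pos[of _ K]) (use True tm in \<open>auto simp: K_def t_def card\<close>)
      have rest: "runs (Cond (Less (Reg reg_m) (Num 1)) (Assign reg_n (Num 0)) decide) s3
        (\<lambda>u s'. u \<le> 1110 * Y \<and> fst s' 0 = (if coverable_below (set xs) k then 1 else 0))"
        if s3: "fst s3 reg_n = int (length xs)" "fst s3 reg_T = t" "fst s3 reg_m = m"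
          "snd s3 = snd (input_state xs k)" for s3
      proof (cases "1 \<le> m")
        case False
        then show ?thesis using iff BY B_def by (simp add: runs_simps s3)
      next
        case m1: True
        have "2 * nat t \<le> E"
          using t_bounds by (simp add: E_def K_def)
        then have P: "2 ^ (2 * nat t) * B ^ 7 \<le> Y"
          unfolding Y by (intro mult_right_mono power_increasing) auto
        have "runs decide s3 (\<lambda>u s'. u \<le> 1100 * (2 ^ (2 * nat t) * B ^ 7) \<and> fst s' 0 =
            (if \<exists>U. U \<subseteq> set xs \<and> card U = nat t \<and> AP_reach (set xs) (nat m) U then 1 else 0))"
          using s3 t_bounds m1 tm True xs
          by (intro runs_decide) (auto simp: B_def n_def)
        moreover have "\<not> bval (Less (Reg reg_m) (Num 1)) s3" using m1 s3 by simp
        ultimately show ?thesis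
          unfolding runs_Cond
          by (simp only: if_False) (erule runs_mono, use m1 BY B_def iff P in auto)
      qed
      have "runs (Seq setup_parameters (Cond (Less (Reg reg_m) (Num 1)) (Assign reg_n (Num 0)) decide)) s2
        (\<lambda>u s'. u \<le> 30 + 1110 * Y \<and> fst s' 0 = (if coverable_below (set xs) k then 1 else 0))"
        unfolding runs_Seq
      proof (rule runs_mono[OF runs_setup_parameters])
        fix u :: nat and s3
        assume *: "u \<le> 30 \<and> snd s3 = snd s2 \<and> fst s3 reg_n = fst s2 reg_n \<and>
          fst s3 reg_T = min (fst s2 reg_n) (3 * fst s2 reg_K) \<and>
          fst s3 reg_m = (if fst s2 reg_n < 3 * fst s2 reg_K then fst s2 reg_half - fst s2 reg_k
            else fst s2 reg_K)"
        show "runs (Cond (Less (Reg reg_m) (Num 1)) (Assign reg_n (Num 0)) decide) s3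
          (\<lambda>u' s'. u + u' \<le> 30 + 1110 * Y \<and>
            fst s' 0 = (if coverable_below (set xs) k then 1 else 0))"
          by (rule runs_mono[OF rest])
            (use * s2 in \<open>auto simp: t_def m_def n_def s0_def\<close>)
      qed
      then show "runs (if bval (Less (Num 0) (Reg reg_K)) s2
          then Seq setup_parameters (Cond (Less (Reg reg_m) (Num 1)) (Assign reg_n (Num 0)) decide)
          else Assign reg_n (Num 1)) s2
         (\<lambda>u s'. t1 + (1 + acost (Add (Add (Reg reg_k) (Reg reg_k))
             (Sub (Sub (Reg reg_n) (Reg reg_half)) (Reg reg_half))) +
             (1 + bcost (Less (Num 0) (Reg reg_K)) + u)) \<le> 2000 * Y \<and>
           fst s' 0 = (if coverable_below (set xs) k then 1 else 0))"
        using True t1 BY unfolding bval.simps aval.simps(1,2) s2 if_P[OF True] B_def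
        by (elim runs_mono) auto
    qed
  qed (auto simp: I_def)
qed

theorem theorem4:
  "\<exists>(p :: com) (C :: nat). \<forall>(X :: int set) (xs :: int list) (k :: int).
     finite X \<and> distinct xs \<and> set xs = X \<longrightarrow>
     (\<exists>t s. exec p (input_state xs k) t s \<and>
        t \<le> C * 2 ^ (C * nat \<bar>k\<bar>) * max 1 (card X) ^ C \<and>
        answer s = (if coverable_below X k then 1 else 0))"
proof -
  \<comment> \<open>One constant, \<open>2000 * 2 ^ 6 * 4 ^ 7\<close>, serves as the factor and as
    both exponents.\<close>
  obtain C :: nat where C: "7 \<le> C" "12 \<le> C" "\<And>x y. 2000 * ((2 ^ 6 * x) * (4 ^ 7 * y)) = C * x * y"
  proof
    show "2000 * ((2 ^ 6 * x) * (4 ^ 7 * y)) = 2097152000 * x * y" for x y :: nat by simp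
  qed simp_all
  have bound: "2000 * (2 ^ (12 * a + 6) * (2 * n + 2) ^ 7) \<le> C * 2 ^ (C * a) * max 1 n ^ C"
    for a n :: nat
  proof -
    \<comment> \<open>The maximum with 1 covers the empty input, where \<open>n ^ C\<close> would be
      0.\<close>
    have "(2 * n + 2) ^ 7 \<le> (4 * max 1 n) ^ 7" by (intro power_mono) auto
    also have "\<dots> = 4 ^ 7 * max 1 n ^ 7" by (rule power_mult_distrib)
    also have "\<dots> \<le> 4 ^ 7 * max 1 n ^ C"
      by (intro mult_left_mono power_increasing C) auto
    finally have n: "(2 * n + 2) ^ 7 \<le> 4 ^ 7 * max 1 n ^ C" .
    have "(2::nat) ^ (12 * a) \<le> 2 ^ (C * a)" by (intro power_increasing mult_right_mono C) auto
    then have "(2::nat) ^ (12 * a + 6) \<le> 2 ^ 6 * 2 ^ (C * a)" by (simp add: power_add)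
    then have "2000 * (2 ^ (12 * a + 6) * (2 * n + 2) ^ 7)
        \<le> 2000 * ((2 ^ 6 * 2 ^ (C * a)) * (4 ^ 7 * max 1 n ^ C))"
      using n by (intro mult_left_mono mult_mono) auto
    also have "\<dots> = C * 2 ^ (C * a) * max 1 n ^ C" by (rule C(3))
    finally show ?thesis .
  qed
  have "\<exists>t s. exec cover_program (input_state xs k) t s \<and>
        t \<le> C * 2 ^ (C * nat \<bar>k\<bar>) * max 1 (card X) ^ C \<and>
        answer s = (if coverable_below X k then 1 else 0)"
    if X: "finite X \<and> distinct xs \<and> set xs = X" for X xs k
  proof -
    have "card X = length xs" using X distinct_card by blast
    moreover obtain t s where "exec cover_program (input_state xs k) t s"
      "t \<le> 2000 * (2 ^ (12 * nat \<bar>k\<bar> + 6) * (2 * length xs + 2) ^ 7)"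
      "fst s 0 = (if coverable_below (set xs) k then 1 else 0)"
      using runs_cover_program[of xs k] X unfolding runs_def by blast
    ultimately show ?thesis
      using X bound[of "nat \<bar>k\<bar>" "length xs"] unfolding answer_def
      by (intro exI[of _ t] exI[of _ s]) (simp only: order_trans[of t])
  qed
  then show ?thesis by blast
qed

end
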